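(* Let $G$ be a connected simple graph with $n$ vertices, let $P$ be a set of $m$ pebbles with vacancy size $k = n-m \ge 2$, and let $f$ and $g$ be two configurations of $P$ on $G$. Then $f \sim g$ if and only if both of the following hold: (1) $R(p,f) = R(p,g)$ for every pebble $p \in P$; (2) if $G$ is a cycle, then the cyclic order of the pebbles of $P$ on $G$ is the same in $f$ and in $g$.
   Context: A configuration of the pebble set $P$ on $G$ is an injective map $f: P \to V(G)$; vertices not in $f(P)$ are unoccupied. A move transfers one pebble to an adjacent unoccupied vertex. Two configurations $f,g$ are equivalent ($f \sim g$) if $f$ can be transformed into $g$ by a finite sequence of moves. The reachable range of $p$ from $f$ is $R(p,f) = \{ h(p) : h \sim f\}$. *)

theory Defs
  imports "Graph_Theory.Graph_Theory" "HOL-Library.FuncSet"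
begin

text \<open>
  Finite simple graphs are the \<open>pair_graph\<close>s of the Graph Theory library: an undirected edge
  \<open>{u, v}\<close> is represented by the two arcs \<open>(u, v)\<close> and \<open>(v, u)\<close>.
\<close>

text \<open>
  Extensional functions, so that a configuration is determined by its values on the pebble set.
\<close>

definition configurations :: "'p set \<Rightarrow> 'v pair_pre_digraph \<Rightarrow> ('p \<Rightarrow> 'v) set" where
  "configurations P G = {f \<in> P \<rightarrow>\<^sub>E pverts G. inj_on f P}"

definition pebble_move ::
    "'p set \<Rightarrow> 'v pair_pre_digraph \<Rightarrow> ('p \<Rightarrow> 'v) \<Rightarrow> ('p \<Rightarrow> 'v) \<Rightarrow> bool" where
  "pebble_move P G f g \<longleftrightarrow>
     (\<exists>p\<in>P. \<exists>v\<in>pverts G. v \<notin> f ` P \<and> (f p, v) \<in> parcs G \<and> g = f(p := v))"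

definition pebble_equiv ::
    "'p set \<Rightarrow> 'v pair_pre_digraph \<Rightarrow> ('p \<Rightarrow> 'v) \<Rightarrow> ('p \<Rightarrow> 'v) \<Rightarrow> bool" where
  "pebble_equiv P G f g \<longleftrightarrow>
     f \<in> configurations P G \<and> g \<in> configurations P G \<and> (pebble_move P G)\<^sup>*\<^sup>* f g"

definition reachable_range ::
    "'p set \<Rightarrow> 'v pair_pre_digraph \<Rightarrow> 'p \<Rightarrow> ('p \<Rightarrow> 'v) \<Rightarrow> 'v set" where
  "reachable_range P G p f = {h p | h. pebble_equiv P G h f}"

text \<open>
  \<open>cyclic_listing G vs\<close>: the list \<open>vs\<close> runs once around \<open>G\<close>. It fixes a starting vertex and a
  direction of traversal.
\<close>

definition cyclic_listing :: "'v pair_pre_digraph \<Rightarrow> 'v list \<Rightarrow> bool" where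
  "cyclic_listing G vs \<longleftrightarrow>
     3 \<le> length vs \<and> distinct vs \<and> set vs = pverts G \<and>
     (\<forall>i<length vs. \<forall>j<length vs.
        (vs ! i, vs ! j) \<in> parcs G \<longleftrightarrow>
          j = Suc i mod length vs \<or> i = Suc j mod length vs)"

definition is_cycle_graph :: "'v pair_pre_digraph \<Rightarrow> bool" where
  "is_cycle_graph G \<longleftrightarrow> (\<exists>vs. cyclic_listing G vs)"

text \<open>
  The cyclic order as a ternary relation: \<open>(p, q, r)\<close> belongs to it iff, going around along \<open>vs\<close>
  from the position of \<open>p\<close>, one meets \<open>q\<close> before \<open>r\<close>, the three being distinct.
\<close>

definition pebble_cyclic_order :: "'p set \<Rightarrow> 'v list \<Rightarrow> ('p \<Rightarrow> 'v) \<Rightarrow> ('p \<times> 'p \<times> 'p) set" where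
  "pebble_cyclic_order P vs f =
     {(p, q, r). p \<in> P \<and> q \<in> P \<and> r \<in> P \<and>
        (\<exists>i j k. i < length vs \<and> j < length vs \<and> k < length vs \<and>
           f p = vs ! i \<and> f q = vs ! j \<and> f r = vs ! k \<and>
           (i < j \<and> j < k \<or> j < k \<and> k < i \<or> k < i \<and> i < j))}"

text \<open>
  Both orders are read in the same direction, so a cyclic order and its reversal count as
  different. Which listing is used does not matter: any two of them differ by a rotation, which
  leaves the relation unchanged, or by a rotation and a reflection, which reverses it for both
  configurations.
\<close>

definition same_cyclic_order ::
    "'p set \<Rightarrow> 'v pair_pre_digraph \<Rightarrow> ('p \<Rightarrow> 'v) \<Rightarrow> ('p \<Rightarrow> 'v) \<Rightarrow> bool" where
  "same_cyclic_order P G f g \<longleftrightarrow>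
     (\<forall>vs. cyclic_listing G vs \<longrightarrow> pebble_cyclic_order P vs f = pebble_cyclic_order P vs g)"

end

theory Submission
  imports Defs "HOL-Combinatorics.Permutations"
begin

text \<open>
  On a graph that is not a cycle, two pebbles with equal ranges can be transposed; since the
  equivalence of configurations is invariant under relabelling, a permutation of the pebbles which
  preserves all ranges is then undone by transpositions. To transpose two pebbles one uses a vertex
  \<open>v\<close> of degree at least three: with a pebble on \<open>v\<close> and two empty neighbours, it can be exchanged
  with the pebble on a third neighbour. Call a pebble on \<open>v\<close> passable if, with the pebble kept
  there, two neighbours of \<open>v\<close> can be emptied. If the common range contains a branch vertex together
  with two of its neighbours, then both pebbles become passable at that vertex, and all pebbles that
  are ever passable at one vertex are exchangeable. Otherwise the common range is a path on which
  the two pebbles cannot overtake each other, so that the ranges differ at an end, or it is the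
  whole of a cycle graph. On a cycle, a configuration can be rotated until a chosen pebble sits at
  the start and the others are packed behind it; the cyclic order determines the result.
\<close>

section \<open>Moves inside a vertex set\<close>

text \<open>Holes are steered, not pebbles, and every rearrangement is confined to a vertex set
  \<open>X\<close>: a pebble is held on \<open>v\<close>, or on a neighbour of \<open>v\<close>, by
  leaving that vertex out of \<open>X\<close>. A pebble that is never passable on \<open>v\<close>
  meets at most one neighbour of \<open>v\<close> in its range, since all holes then lie behind the
  neighbour by which it leaves, and it can only return the same way. This is why two neighbours of
  \<open>v\<close> in the range force passability. The obstacle is that passability belongs to a
  configuration, not to a pebble: between two passable visits to \<open>v\<close>, other pebbles may
  enter \<open>v\<close> and be stuck there, so the two visits cannot be compared directly. Instead
  \<open>class_at\<close> follows, move by move, an exchangeability class that always has a member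
  on \<open>v\<close>, ready to be put there, or waiting on a neighbour. Equal ranges of two
  different pebbles come from relabelling: if \<open>g = f \<circ> \<pi>\<close>, then the range of
  \<open>p\<close> from \<open>g\<close> is that of \<open>\<pi> p\<close> from
  \<open>f\<close>.\<close>

locale pebble_puzzle = pair_graph G for G :: "'v pair_pre_digraph" +
  fixes P :: "'p set"
  assumes connected_G: "connected (with_proj G)"
    and finite_P: "finite P"
    and two_holes: "card P + 2 \<le> card (pverts G)"
begin

abbreviation "V \<equiv> pverts G"

abbreviation adj :: "'v \<Rightarrow> 'v \<Rightarrow> bool" where
  "adj x y \<equiv> (x, y) \<in> parcs G"

abbreviation nbrs :: "'v \<Rightarrow> 'v set" where
  "nbrs v \<equiv> {x. adj v x}"

abbreviation "S \<equiv> configurations P G"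

definition hole :: "('p \<Rightarrow> 'v) \<Rightarrow> 'v \<Rightarrow> bool" where
  "hole s y \<longleftrightarrow> y \<in> V \<and> y \<notin> s ` P"

text \<open>Reflexive at every vertex, even outside \<open>X\<close>; membership in \<open>X\<close>
  can be recovered only for distinct endpoints (\<open>conn_mem\<close>), hence the separate
  assumptions \<open>x \<in> X\<close> later on.\<close>

definition conn :: "'v set \<Rightarrow> 'v \<Rightarrow> 'v \<Rightarrow> bool" where
  "conn X = (\<lambda>x y. adj x y \<and> x \<in> X \<and> y \<in> X)\<^sup>*\<^sup>*"

text \<open>Both ends of the move must lie in \<open>X\<close>, so a pebble outside \<open>X\<close>
  is frozen and cannot be displaced (\<open>reach_in_outside\<close>).\<close>

definition move_in :: "'v set \<Rightarrow> ('p \<Rightarrow> 'v) \<Rightarrow> ('p \<Rightarrow> 'v) \<Rightarrow> bool" where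
  "move_in X s t \<longleftrightarrow> (\<exists>p\<in>P. \<exists>y. hole s y \<and> adj (s p) y \<and> s p \<in> X \<and> y \<in> X \<and> t = s(p := y))"

definition reach_in :: "'v set \<Rightarrow> ('p \<Rightarrow> 'v) \<Rightarrow> ('p \<Rightarrow> 'v) \<Rightarrow> bool" where
  "reach_in X = (move_in X)\<^sup>*\<^sup>*"

section \<open>Connectivity inside a vertex set\<close>

lemma adj_sym: "adj x y \<Longrightarrow> adj y x"
  by (rule arcs_symmetric)

lemma adj_neq: "adj x y \<Longrightarrow> x \<noteq> y"
  using no_loops by fastforce

lemma adj_V: "adj x y \<Longrightarrow> x \<in> V" "adj x y \<Longrightarrow> y \<in> V"
  using wellformed by fastforce+

lemma finite_nbrs: "finite (nbrs v)"
  by (rule finite_subset[OF _ pair_finite_verts]) (auto dest: adj_V)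

lemma conn_refl [simp]: "conn X x x"
  by (simp add: conn_def)

lemma conn_edge: "adj x y \<Longrightarrow> x \<in> X \<Longrightarrow> y \<in> X \<Longrightarrow> conn X x y"
  by (auto simp: conn_def)

lemma conn_trans: "conn X x y \<Longrightarrow> conn X y z \<Longrightarrow> conn X x z"
  unfolding conn_def by (rule rtranclp_trans)

lemma conn_sym:
  assumes "conn X x y"
  shows "conn X y x"
proof -
  have "symp (\<lambda>x y. adj x y \<and> x \<in> X \<and> y \<in> X)"
    by (rule sympI) (auto intro: adj_sym)
  from sympD[OF symp_rtranclp[OF this]] assms show ?thesis
    unfolding conn_def .
qed

lemma conn_mono: "conn X x y \<Longrightarrow> X \<subseteq> Y \<Longrightarrow> conn Y x y"
  unfolding conn_def by (erule rtranclp_mono[THEN predicate2D, rotated]) auto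

lemma conn_mem: "conn X x y \<Longrightarrow> x = y \<or> (x \<in> X \<and> y \<in> X)"
  unfolding conn_def by (induction rule: rtranclp_induct) auto

lemma conn_induct [consumes 1, case_names refl step]:
  assumes "conn X x y" "Q x"
    "\<And>y z. conn X x y \<Longrightarrow> adj y z \<Longrightarrow> y \<in> X \<Longrightarrow> z \<in> X \<Longrightarrow> Q y \<Longrightarrow> Q z"
  shows "Q y"
  using assms(1) unfolding conn_def
  by (induction rule: rtranclp_induct) (use assms(2,3) in \<open>auto simp: conn_def\<close>)

lemma conn_converse_induct [consumes 1, case_names refl step]:
  assumes "conn X x y" "Q y"
    "\<And>x z. conn X z y \<Longrightarrow> adj x z \<Longrightarrow> x \<in> X \<Longrightarrow> z \<in> X \<Longrightarrow> Q z \<Longrightarrow> Q x"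
  shows "Q x"
  using assms(1) unfolding conn_def
  by (induction rule: converse_rtranclp_induct) (use assms(2,3) in \<open>auto simp: conn_def\<close>)

lemma conn_step: "conn X x y \<Longrightarrow> adj y z \<Longrightarrow> y \<in> X \<Longrightarrow> z \<in> X \<Longrightarrow> conn X x z"
  by (blast intro: conn_trans conn_edge)

lemma conn_V:
  assumes "x \<in> V" "y \<in> V"
  shows "conn V x y"
proof -
  have "strongly_connected (with_proj G)"
    by (rule symmetric_connected_imp_strongly_connected[OF sym_arcs connected_G])
  then have "x \<rightarrow>\<^sup>*\<^bsub>with_proj G\<^esub> y"
    using assms by (auto simp: strongly_connected_def)
  then show ?thesis
  proof (induction rule: reachable_induct)
    case base
    then show ?case by simp
  next
    case (step y z)
    then show ?case by (auto intro: conn_step dest: adj_V)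
  qed
qed

text \<open>Cut the path at its first vertex in \<open>Y\<close>. With \<open>Y\<close> a set of
  neighbours of \<open>v\<close>, this leaves only one of them among the vertices that later moves
  may disturb.\<close>

lemma conn_first_hit:
  assumes "conn X x y" "y \<in> Y"
  obtains y' where "y' \<in> Y" "conn ((X - Y) \<union> {y'}) x y'"
proof -
  from assms have "\<exists>y'\<in>Y. conn ((X - Y) \<union> {y'}) x y'"
  proof (induction rule: conn_converse_induct)
    case refl
    then show ?case by (intro bexI[of _ y]) auto
  next
    case (step x z)
    then obtain y' where y': "y' \<in> Y" "conn ((X - Y) \<union> {y'}) z y'" by blast
    show ?case
    proof (cases "x \<in> Y \<or> z \<in> Y")
      case True
      then show ?thesis
      proof (cases "x \<in> Y")
        case False
        with True step.hyps show ?thesis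
          by (intro bexI[of _ z] conn_edge) auto
      qed (auto intro!: bexI[of _ x])
    next
      case False
      with step.hyps have "conn ((X - Y) \<union> {y'}) x z" by (intro conn_edge) auto
      with y' show ?thesis by (blast intro: conn_trans)
    qed
  qed
  with that show thesis by blast
qed

text \<open>Connectedness of the graph gives a path from \<open>w\<close> to \<open>v\<close>; it is
  cut just before it meets \<open>v\<close>.\<close>

lemma conn_nbr:
  assumes "v \<in> V" "w \<in> V" "w \<noteq> v"
  obtains a where "adj v a" "conn (V - {v}) w a"
proof -
  have "conn V w v" using assms conn_V by blast
  then have "w = v \<or> (\<exists>a. adj v a \<and> conn (V - {v}) w a)"
  proof (induction rule: conn_converse_induct)
    case (step x z)
    show ?case
    proof (cases "x = v \<or> z = v")
      case True
      with step.hyps show ?thesis by (auto intro: adj_sym)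
    next
      case False
      with step obtain a where a: "adj v a" "conn (V - {v}) z a" by blast
      from False step.hyps have "conn (V - {v}) x z" by (intro conn_edge) auto
      with a show ?thesis by (blast intro: conn_trans)
    qed
  qed simp
  with assms that show thesis by blast
qed

section \<open>Configurations and confined moves\<close>

lemma S_iff: "s \<in> S \<longleftrightarrow> s \<in> P \<rightarrow>\<^sub>E V \<and> inj_on s P"
  by (simp add: configurations_def)

lemma S_V: "s \<in> S \<Longrightarrow> p \<in> P \<Longrightarrow> s p \<in> V"
  by (auto simp: S_iff)

lemma S_inj: "s \<in> S \<Longrightarrow> p \<in> P \<Longrightarrow> q \<in> P \<Longrightarrow> s p = s q \<longleftrightarrow> p = q"
  by (auto simp: S_iff inj_on_def)

lemma S_eqI: "s \<in> S \<Longrightarrow> t \<in> S \<Longrightarrow> (\<And>p. p \<in> P \<Longrightarrow> s p = t p) \<Longrightarrow> s = t"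
  unfolding S_iff by (auto intro: PiE_ext)

lemma not_hole: "y \<in> V \<Longrightarrow> \<not> hole s y \<longleftrightarrow> (\<exists>p\<in>P. s p = y)"
  by (auto simp: hole_def)

lemma hole_V: "hole s y \<Longrightarrow> y \<in> V"
  by (simp add: hole_def)

lemma hole_neq: "hole s y \<Longrightarrow> p \<in> P \<Longrightarrow> s p \<noteq> y"
  by (auto simp: hole_def)

lemma upd_S:
  assumes "s \<in> S" "hole s y" "p \<in> P"
  shows "s(p := y) \<in> S"
  using assms unfolding S_iff
  by (auto simp: hole_def inj_on_def PiE_iff extensional_def)

lemma hole_upd:
  assumes "s \<in> S" "p \<in> P"
  shows "hole (s(p := y)) z \<longleftrightarrow> (z = s p \<and> z \<noteq> y) \<or> (hole s z \<and> z \<noteq> y)"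
  using assms by (auto simp: hole_def S_V S_inj)

lemma move_in_S: "s \<in> S \<Longrightarrow> move_in X s t \<Longrightarrow> t \<in> S"
  by (auto simp: move_in_def upd_S)

lemma move_in_sym:
  assumes "s \<in> S" "move_in X s t"
  shows "move_in X t s"
proof -
  from assms obtain p y where *: "p \<in> P" "hole s y" "adj (s p) y" "s p \<in> X" "y \<in> X" "t = s(p := y)"
    by (auto simp: move_in_def)
  then have "hole t (s p)" using assms by (auto simp: hole_upd hole_neq)
  moreover have "s = t(p := s p)" using * by simp
  ultimately show ?thesis using * unfolding move_in_def
    by (intro bexI[of _ p] exI[of _ "s p"]) (auto intro: adj_sym)
qed

lemma move_in_mono: "move_in X s t \<Longrightarrow> X \<subseteq> Y \<Longrightarrow> move_in Y s t"
  unfolding move_in_def by blast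

lemma reach_in_refl [simp]: "reach_in X s s"
  by (simp add: reach_in_def)

lemma reach_in_trans: "reach_in X s t \<Longrightarrow> reach_in X t u \<Longrightarrow> reach_in X s u"
  unfolding reach_in_def by (rule rtranclp_trans)

lemma reach_in_move: "move_in X s t \<Longrightarrow> reach_in X s t"
  unfolding reach_in_def by blast

lemma reach_in_mono: "reach_in X s t \<Longrightarrow> X \<subseteq> Y \<Longrightarrow> reach_in Y s t"
  unfolding reach_in_def
  by (erule rtranclp_mono[THEN predicate2D, rotated]) (auto intro: move_in_mono)

lemma reach_in_induct [consumes 2, case_names refl step]:
  assumes "reach_in X s t" "s \<in> S" "Q s"
    "\<And>t u. reach_in X s t \<Longrightarrow> t \<in> S \<Longrightarrow> move_in X t u \<Longrightarrow> u \<in> S \<Longrightarrow> Q t \<Longrightarrow> Q u"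
  shows "Q t"
proof -
  from assms(1) have "t \<in> S \<and> Q t" unfolding reach_in_def
    by (induction rule: rtranclp_induct)
      (use assms(2-4) in \<open>auto simp: reach_in_def intro: move_in_S\<close>)
  then show ?thesis ..
qed

lemma reach_in_S: "s \<in> S \<Longrightarrow> reach_in X s t \<Longrightarrow> t \<in> S"
  by (rule reach_in_induct[of X s t]) auto

lemma reach_in_sym:
  assumes "s \<in> S" "reach_in X s t"
  shows "reach_in X t s"
  using assms(2,1)
proof (induction rule: reach_in_induct)
  case (step t u)
  then show ?case using reach_in_trans[OF reach_in_move[OF move_in_sym]] by metis
qed simp

lemma reach_in_outside:
  assumes "s \<in> S" "reach_in X s t" "p \<in> P" "s p \<notin> X"
  shows "t p = s p"
  using assms(2,1) by (induction rule: reach_in_induct) (use assms in \<open>auto simp: move_in_def\<close>)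

text \<open>Only the occupied set is controlled, not which pebble goes where. Induction along the
  path: if the last but one vertex is empty, the final pebble steps onto it and the shorter path
  finishes; otherwise the shorter path vacates that vertex and the final pebble steps in.\<close>

lemma exchange_hole:
  assumes "conn X x y" "s \<in> S" "x \<in> X" "hole s x" "y \<in> s ` P"
  shows "\<exists>t. reach_in X s t \<and> t ` P = insert x (s ` P - {y})"
  using assms
proof (induction arbitrary: s rule: conn_induct)
  case refl
  then show ?case by (auto simp: hole_def)
next
  case (step y z)
  obtain p where p: "p \<in> P" "s p = z" using step.prems by auto
  show ?case
  proof (cases "hole s y")
    case True
    define s1 where "s1 = s(p := y)"
    have mv: "move_in X s s1"
      unfolding move_in_def s1_def using step.hyps p True by (auto intro: adj_sym)
    have im: "s1 ` P = insert y (s ` P - {z})"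
      using p step.prems(1) by (auto simp: s1_def S_inj)
    show ?thesis
    proof (cases "x = y")
      case True
      with mv im show ?thesis by (blast intro: reach_in_move)
    next
      case False
      have "s1 \<in> S" using mv step.prems move_in_S by blast
      moreover have "hole s1 x" using False step.prems p by (auto simp: hole_def im)
      ultimately obtain t where "reach_in X s1 t" "t ` P = insert x (s1 ` P - {y})"
        using step.IH step.prems im by blast
      moreover have "y \<notin> s ` P" using True by (simp add: hole_def)
      then have "insert x (s1 ` P - {y}) = insert x (s ` P - {z})"
        using im by auto
      ultimately show ?thesis using mv by (metis reach_in_trans reach_in_move)
    qed
  next
    case False
    then have "y \<in> s ` P" using step.hyps by (auto simp: hole_def dest: adj_V)
    then obtain t where t: "reach_in X s t" "t ` P = insert x (s ` P - {y})"
      using step by blast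
    have tS: "t \<in> S" using t step.prems reach_in_S by blast
    have yz: "y \<noteq> z" using step.hyps adj_neq by blast
    have xy: "x \<noteq> y" using \<open>y \<in> s ` P\<close> step.prems by (auto simp: hole_def)
    have hy: "hole t y" using t xy step.hyps by (auto simp: hole_def dest: adj_V)
    have "z \<in> t ` P" using t p yz by auto
    then obtain q where q: "q \<in> P" "t q = z" by auto
    have "move_in X t (t(q := y))"
      unfolding move_in_def using q hy step.hyps by (auto intro: adj_sym)
    moreover have "t(q := y) ` P = insert x (s ` P - {z})"
      using q tS t(2) \<open>y \<in> s ` P\<close> yz xy step.prems p by (auto simp: S_inj hole_def image_iff) 
    ultimately show ?thesis using t(1) by (blast intro: reach_in_trans reach_in_move)
  qed
qed

lemma conn_in_V: "conn X x y \<Longrightarrow> x \<in> V \<Longrightarrow> y \<in> V"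
  by (induction rule: conn_induct) (auto dest: adj_V)

lemma reach_in_upd:
  "p \<in> P \<Longrightarrow> hole s y \<Longrightarrow> adj (s p) y \<Longrightarrow> s p \<in> X \<Longrightarrow> y \<in> X \<Longrightarrow> reach_in X s (s(p := y))"
  by (intro reach_in_move) (auto simp: move_in_def)

lemma shift_hole:
  assumes "s \<in> S" "hole s x" "x \<in> X" "conn X x y"
  obtains t where "reach_in X s t" "hole t y"
proof (cases "hole s y")
  case True
  with that show thesis using reach_in_refl by blast
next
  case False
  have "y \<in> V" using assms conn_in_V hole_V by blast
  with False have "y \<in> s ` P" by (simp add: hole_def)
  with assms obtain t where t: "reach_in X s t" "t ` P = insert x (s ` P - {y})"
    using exchange_hole by blast
  moreover have "x \<noteq> y" using False assms by blast
  ultimately have "hole t y" using \<open>y \<in> V\<close> by (auto simp: hole_def)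
  with t that show thesis by blast
qed

text \<open>
  If the moving hole has to pass through the kept hole \<open>a\<close>, the two travel on as an adjacent pair
  which then carries a pebble over two edges; hence the last conjunct.
\<close>

lemma shift_hole_keeping_aux:
  assumes "conn X w e" "s \<in> S" "hole s a" "hole s w" "a \<noteq> w" "a \<in> X" "w \<in> X"
  shows "\<exists>t. reach_in X s t \<and> hole t a \<and> (e \<noteq> a \<longrightarrow> hole t e) \<and>
    (e = a \<longrightarrow> (\<exists>x\<in>X. adj x a \<and> hole t x))"
  using assms
proof (induction rule: conn_induct)
  case refl
  then show ?case by (intro exI[of _ s]) auto
next
  case (step y z)
  then obtain t where t: "reach_in X s t" "hole t a" "y \<noteq> a \<Longrightarrow> hole t y"
    "y = a \<Longrightarrow> \<exists>x\<in>X. adj x a \<and> hole t x" by blast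
  have tS: "t \<in> S" using t step.prems reach_in_S by blast
  consider "y \<noteq> a" "z = a" | "z \<noteq> a" "hole t z" | "z \<noteq> a" "y \<noteq> a" "\<not> hole t z"
    | "z \<noteq> a" "y = a" "\<not> hole t z"
    using adj_neq[OF step.hyps(2)] by blast
  then show ?case
  proof cases
    case 1
    with t step.hyps show ?thesis by (intro exI[of _ t]) auto
  next
    case 2
    with t show ?thesis by (intro exI[of _ t]) auto
  next
    case 3
    then obtain p where p: "p \<in> P" "t p = z" using not_hole step.hyps adj_V by metis
    have "hole t y" using 3 t by blast
    then have "reach_in X t (t(p := y))"
      using p step.hyps by (intro reach_in_upd) (auto intro: adj_sym)
    moreover have "hole (t(p := y)) a" "hole (t(p := y)) z"
      using 3 p t adj_neq[OF step.hyps(2)] by (auto simp: hole_upd[OF tS])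
    ultimately show ?thesis using 3 t(1) reach_in_trans by blast
  next
    case 4
    then obtain p where p: "p \<in> P" "t p = z" using not_hole step.hyps adj_V by metis
    obtain x where x: "x \<in> X" "adj x a" "hole t x" using 4 t by blast
    have zx: "z \<noteq> x" "x \<noteq> a" using x 4 adj_neq by blast+
    let ?t1 = "t(p := a)" and ?t2 = "t(p := x)"
    have "reach_in X t ?t1"
      using p step.hyps t 4 by (intro reach_in_upd) (auto intro: adj_sym)
    moreover have "reach_in X ?t1 (?t1(p := x))"
      using p step.prems x zx by (intro reach_in_upd) (auto intro: adj_sym simp: hole_upd[OF tS])
    then have "reach_in X ?t1 ?t2" by simp
    moreover have "hole ?t2 a" "hole ?t2 z"
      using 4 p t zx by (auto simp: hole_upd[OF tS])
    ultimately show ?thesis using 4 t(1) reach_in_trans by blast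
  qed
qed

lemma shift_hole_keeping:
  assumes "s \<in> S" "hole s a" "hole s w" "a \<noteq> w" "a \<in> X" "w \<in> X" "conn X w e" "e \<noteq> a"
  obtains t where "reach_in X s t" "hole t a" "hole t e"
  using shift_hole_keeping_aux[OF assms(7,1-6)] assms(8) that by blast

text \<open>While some vertex of \<open>J\<close> is empty, equal cardinalities provide an occupied
  vertex of \<open>X\<close> outside \<open>J\<close>, and \<open>exchange_hole\<close> trades one
  for the other; the number of empty vertices of \<open>J\<close> drops.\<close>

lemma arrange_holes:
  assumes "s \<in> S" "\<And>x y. x \<in> X \<Longrightarrow> y \<in> X \<Longrightarrow> conn X x y" "X \<subseteq> V" "J \<subseteq> X"
    "card J = card (s ` P \<inter> X)"
  shows "\<exists>t. reach_in X s t \<and> t ` P \<inter> X = J"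
  using assms(1,5)
proof (induction "card (J - s ` P)" arbitrary: s rule: less_induct)
  case less
  have finJ: "finite J" using assms(3,4) pair_finite_verts by (meson finite_subset)
  have finI: "finite (s ` P \<inter> X)" using finite_P by blast
  show ?case
  proof (cases "J \<subseteq> s ` P")
    case True
    then have "J = s ` P \<inter> X"
      using less.prems(2) assms(4) finI by (intro card_subset_eq) auto
    then show ?thesis by (intro exI[of _ s]) simp
  next
    case False
    then obtain x where x: "x \<in> J" "x \<notin> s ` P" by blast
    have "\<not> s ` P \<inter> X \<subseteq> J"
      using card_subset_eq[OF finJ] less.prems(2) x by auto
    then obtain y where y: "y \<in> s ` P" "y \<in> X" "y \<notin> J" by blast
    have "conn X x y" "x \<in> X" "hole s x"
      using x y assms by (auto simp: hole_def)
    then obtain t where t: "reach_in X s t" "t ` P = insert x (s ` P - {y})"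
      using exchange_hole less.prems y by blast
    have tX: "t ` P \<inter> X = insert x (s ` P \<inter> X - {y})" using t \<open>x \<in> X\<close> by blast
    have "card (t ` P \<inter> X) = Suc (card (s ` P \<inter> X - {y}))"
      unfolding tX by (rule card_insert_disjoint) (use finI x in blast)+
    also have "\<dots> = card (s ` P \<inter> X)"
      by (rule card_Suc_Diff1) (use finI y in blast)+
    finally have ct: "card (t ` P \<inter> X) = card (s ` P \<inter> X)" .
    have "J - t ` P = J - s ` P - {x}" using x y unfolding t(2) by auto
    then have "J - t ` P \<subset> J - s ` P" using x by auto
    then have lt: "card (J - t ` P) < card (J - s ` P)"
      using finJ by (intro psubset_card_mono) auto
    have tS: "t \<in> S" using t less.prems reach_in_S by blast
    obtain u where "reach_in X t u" "u ` P \<inter> X = J"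
      using less.hyps[OF lt tS] less.prems(2) ct by auto
    then show ?thesis using t reach_in_trans by blast
  qed
qed

section \<open>Exchangeable pebbles\<close>

definition eqv :: "('p \<Rightarrow> 'v) \<Rightarrow> ('p \<Rightarrow> 'v) \<Rightarrow> bool" where
  "eqv s t \<longleftrightarrow> s \<in> S \<and> t \<in> S \<and> reach_in V s t"

lemma pebble_equiv_eq: "pebble_equiv P G = eqv"
proof -
  have "pebble_move P G = move_in V"
    by (intro ext) (auto simp: pebble_move_def move_in_def hole_def dest: adj_V)
  then show ?thesis by (intro ext) (simp add: pebble_equiv_def eqv_def reach_in_def)
qed

lemma eqvD: "eqv s t \<Longrightarrow> s \<in> S" "eqv s t \<Longrightarrow> t \<in> S"
  by (simp_all add: eqv_def)

lemma eqv_refl: "s \<in> S \<Longrightarrow> eqv s s"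
  by (simp add: eqv_def)

lemma eqv_sym: "eqv s t \<Longrightarrow> eqv t s"
  by (auto simp: eqv_def intro: reach_in_sym)

lemma eqv_trans: "eqv s t \<Longrightarrow> eqv t u \<Longrightarrow> eqv s u"
  by (auto simp: eqv_def intro: reach_in_trans)

lemma reach_in_V:
  assumes "reach_in X s t"
  shows "reach_in V s t"
proof -
  have "move_in X s t \<Longrightarrow> move_in V s t" for s t
    unfolding move_in_def using adj_V by blast
  then show ?thesis using assms unfolding reach_in_def
    by (elim rtranclp_mono[THEN predicate2D, rotated]) auto
qed

lemma eqv_reach: "s \<in> S \<Longrightarrow> reach_in X s t \<Longrightarrow> eqv s t"
  by (auto simp: eqv_def intro: reach_in_S reach_in_V)

lemma eqv_upd: "s \<in> S \<Longrightarrow> p \<in> P \<Longrightarrow> hole s y \<Longrightarrow> adj (s p) y \<Longrightarrow> eqv s (s(p := y))"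
  by (rule eqv_reach[of _ V], assumption, rule reach_in_upd) (auto dest: adj_V)

section \<open>Relabelling and exchange of pebbles\<close>

lemma relabel_S:
  assumes "s \<in> S" "\<pi> permutes P"
  shows "s \<circ> \<pi> \<in> S"
proof -
  have "inj_on (s \<circ> \<pi>) P"
    using assms by (intro comp_inj_on) (auto simp: S_iff permutes_image intro: permutes_inj_on)
  moreover have "s \<circ> \<pi> \<in> P \<rightarrow>\<^sub>E V"
    using assms by (auto simp: S_iff PiE_iff extensional_def permutes_in_image)
  ultimately show ?thesis by (simp add: S_iff)
qed

lemma hole_relabel: "\<pi> permutes P \<Longrightarrow> hole (s \<circ> \<pi>) y \<longleftrightarrow> hole s y"
  by (simp only: hole_def image_comp[symmetric] permutes_image)

text \<open>Which moves exist depends only on the occupied vertices: in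
  \<open>s \<circ> \<pi>\<close> the vertex \<open>s p\<close> carries the pebble
  \<open>inv \<pi> p\<close>, and this one makes the move.\<close>

lemma move_in_relabel:
  assumes "move_in X s t" "\<pi> permutes P"
  shows "move_in X (s \<circ> \<pi>) (t \<circ> \<pi>)"
proof -
  obtain p y where *: "p \<in> P" "hole s y" "adj (s p) y" "s p \<in> X" "y \<in> X" "t = s(p := y)"
    using assms by (auto simp: move_in_def)
  have "t \<circ> \<pi> = (s \<circ> \<pi>)(inv \<pi> p := y)"
    using * assms(2) by (auto simp: fun_eq_iff permutes_inverses)
  moreover have "inv \<pi> p \<in> P" using * assms by (simp add: permutes_in_image permutes_inv)
  moreover have "(s \<circ> \<pi>) (inv \<pi> p) = s p" using assms by (simp add: permutes_inverses)
  ultimately show ?thesis unfolding move_in_def using * assms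
    by (intro bexI[of _ "inv \<pi> p"] exI[of _ y]) (simp_all add: hole_relabel)
qed

lemma eqv_relabel:
  assumes "eqv s t" "\<pi> permutes P"
  shows "eqv (s \<circ> \<pi>) (t \<circ> \<pi>)"
proof -
  have "s \<in> S" "reach_in V s t" using assms by (auto simp: eqv_def)
  from this(2,1) have "reach_in V (s \<circ> \<pi>) (t \<circ> \<pi>)"
  proof (induction rule: reach_in_induct)
    case (step t u)
    then show ?case
      using reach_in_trans reach_in_move move_in_relabel[OF _ assms(2)] by blast
  qed simp
  then show ?thesis using assms unfolding eqv_def by (blast intro: relabel_S)
qed

definition xch :: "('p \<Rightarrow> 'v) \<Rightarrow> 'p \<Rightarrow> 'p \<Rightarrow> bool" where
  "xch s p q \<longleftrightarrow> p \<in> P \<and> q \<in> P \<and> eqv s (s \<circ> transpose p q)"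

lemma transpose_permutes: "p \<in> P \<Longrightarrow> q \<in> P \<Longrightarrow> transpose p q permutes P"
  by (rule permutes_swap_id)

text \<open>Exchangeability is a property of the equivalence class, so it may be tested at whichever
  configuration is convenient.\<close>

lemma xch_eqv:
  assumes "xch s p q" "eqv s t"
  shows "xch t p q"
  using assms unfolding xch_def
  by (meson eqv_relabel eqv_sym eqv_trans transpose_permutes)

lemma xch_refl: "s \<in> S \<Longrightarrow> p \<in> P \<Longrightarrow> xch s p p"
  by (simp add: xch_def eqv_refl)

lemma xch_sym: "xch s p q \<Longrightarrow> xch s q p"
  by (simp add: xch_def transpose_commute)

text \<open>Rests on (p r) = (p q)(q r)(p q); relabelling transports the equivalences of the single
  factors to the product.\<close>

lemma xch_trans:
  assumes "xch s p q" "xch s q r"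
  shows "xch s p r"
proof (cases "p = q \<or> q = r \<or> p = r")
  case True
  then show ?thesis using assms xch_refl by (auto simp: xch_def dest: eqvD)
next
  case False
  let ?a = "transpose p q" and ?b = "transpose q r"
  have P: "p \<in> P" "q \<in> P" "r \<in> P" using assms by (auto simp: xch_def)
  have 1: "eqv s (s \<circ> ?a)" "eqv s (s \<circ> ?b)" using assms by (auto simp: xch_def)
  have "eqv (s \<circ> ?a) (s \<circ> ?b \<circ> ?a)"
    using 1 P by (intro eqv_relabel transpose_permutes)
  moreover have "eqv (s \<circ> ?a \<circ> ?b \<circ> ?a) (s \<circ> ?b \<circ> ?a)"
    using 1 P by (intro eqv_relabel transpose_permutes) (meson eqv_relabel eqv_sym eqv_trans transpose_permutes)
  ultimately have "eqv s (s \<circ> ?a \<circ> ?b \<circ> ?a)" using 1 eqv_sym eqv_trans by blast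
  moreover have "?a \<circ> ?b \<circ> ?a = transpose p r"
    using False by (auto simp: fun_eq_iff transpose_def)
  ultimately show ?thesis using P by (simp add: xch_def comp_assoc)
qed

text \<open>On the star with centre \<open>s p\<close>: \<open>p\<close> steps aside to
  \<open>a\<close>, \<open>q\<close> passes through the centre to \<open>b\<close>, \<open>p\<close>
  returns and goes on to the old place of \<open>q\<close>, and \<open>q\<close> enters the
  centre.\<close>

lemma star_exchange:
  assumes "s \<in> S" "p \<in> P" "q \<in> P" "p \<noteq> q" "adj (s p) a" "adj (s p) b" "adj (s p) (s q)" "a \<noteq> b"
    "hole s a" "hole s b"
  shows "xch s p q"
proof -
  let ?v = "s p" and ?c = "s q"
  have ne: "a \<noteq> ?v" "b \<noteq> ?v" "?c \<noteq> ?v" "a \<noteq> ?c" "b \<noteq> ?c"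
    using adj_neq[OF assms(5)] adj_neq[OF assms(6)] adj_neq[OF assms(7)] assms(2,3,9,10)
    by (auto simp: hole_def)
  have V: "a \<in> V" "b \<in> V" "?v \<in> V" "?c \<in> V" using assms(5-7) adj_V by blast+
  have [simp]: "s r \<noteq> a" "s r \<noteq> b" "a \<noteq> s r" "b \<noteq> s r"
    "s r = ?v \<longleftrightarrow> r = p" "?v = s r \<longleftrightarrow> p = r"
    "s r = ?c \<longleftrightarrow> r = q" "?c = s r \<longleftrightarrow> q = r" if "r \<in> P" for r
    using that assms by (auto simp: hole_def S_inj)
  note [simp] = hole_def V assms(2-8) ne ne[symmetric] assms(4)[symmetric] assms(8)[symmetric]
  note [intro] = adj_sym assms(1)
  let ?s1 = "s(p := a)" and ?s2 = "s(p := a, q := ?v)" and ?s3 = "s(p := a, q := b)"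
    and ?s4 = "s(p := ?v, q := b)" and ?s5 = "s(p := ?c, q := b)" and ?s6 = "s(p := ?c, q := ?v)"
  have 1: "eqv s ?s1" by (rule eqv_upd) auto
  have 2: "eqv ?s1 ?s2" using eqvD(2)[OF 1] by (intro eqv_upd) auto
  have "eqv ?s2 (?s2(q := b))" using eqvD(2)[OF 2] by (intro eqv_upd) auto
  then have 3: "eqv ?s2 ?s3" by simp
  have "eqv ?s3 (?s3(p := ?v))" using eqvD(2)[OF 3] by (intro eqv_upd) auto
  moreover have "?s3(p := ?v) = ?s4" by (auto simp: fun_eq_iff)
  ultimately have 4: "eqv ?s3 ?s4" by simp
  have "eqv ?s4 (?s4(p := ?c))" using eqvD(2)[OF 4] by (intro eqv_upd) auto
  moreover have "?s4(p := ?c) = ?s5" by (auto simp: fun_eq_iff)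
  ultimately have 5: "eqv ?s4 ?s5" by simp
  have "eqv ?s5 (?s5(q := ?v))" using eqvD(2)[OF 5] by (intro eqv_upd) auto
  then have 6: "eqv ?s5 ?s6" by simp
  have "eqv s ?s6" using 1 2 3 4 5 6 by (meson eqv_trans)
  moreover have "?s6 = s \<circ> transpose p q" by (auto simp: fun_eq_iff transpose_def)
  ultimately show ?thesis by (simp add: xch_def)
qed

section \<open>Passing through a branch vertex\<close>

text \<open>Static form of passability: no moves occur, only two holes linked off \<open>v\<close>
  to two different neighbours. That the holes can really be driven there one after the other is
  \<open>passable_two_holes\<close>. The vertex \<open>v\<close> itself cannot serve as
  \<open>w\<close> or \<open>w'\<close>, since the links avoid it.\<close>

definition passable :: "'v \<Rightarrow> ('p \<Rightarrow> 'v) \<Rightarrow> bool" where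
  "passable v s \<longleftrightarrow> (\<exists>w w' a e. hole s w \<and> hole s w' \<and> w \<noteq> w' \<and> a \<noteq> e \<and> adj v a \<and> adj v e \<and>
     conn (V - {v}) w a \<and> conn (V - {v}) w' e)"

text \<open>Moves confined to \<open>far v\<close> and two chosen neighbours disturb neither
  \<open>v\<close> nor any other neighbour of \<open>v\<close>.\<close>

abbreviation far :: "'v \<Rightarrow> 'v set" where
  "far v \<equiv> V - {v} - nbrs v"

text \<open>This is where vacancy size at least two enters: besides any given vertex there is a
  further hole.\<close>

lemma other_hole:
  assumes "s \<in> S"
  obtains w where "hole s w" "w \<noteq> x"
proof -
  have "card (V - s ` P) = card V - card P"
    using assms finite_P by (subst card_Diff_subset) (auto simp: S_iff card_image)
  then have "\<not> V - s ` P \<subseteq> {x}"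
    using two_holes card_mono[of "{x}" "V - s ` P"] by fastforce
  with that show thesis by (auto simp: hole_def)
qed

lemma third_nbr:
  assumes "3 \<le> card (nbrs v)"
  obtains c where "adj v c" "c \<noteq> a" "c \<noteq> b"
proof -
  have "card {a, b} \<le> 2" by (simp add: card_insert_if)
  then have "\<not> nbrs v \<subseteq> {a, b}"
    using assms card_mono[of "{a, b}" "nbrs v"] by fastforce
  with that show thesis by blast
qed

lemma passable_reach:
  assumes "s \<in> S" "reach_in (V - {v}) s t" "passable v s"
  shows "passable v t"
  using assms(2,1)
proof (induction rule: reach_in_induct)
  case (step t u)
  obtain p y where p: "p \<in> P" "hole t y" "adj (t p) y" "t p \<in> V - {v}" "y \<in> V - {v}" "u = t(p := y)"
    using step by (auto simp: move_in_def)
  obtain w w' a e where w: "hole t w" "hole t w'" "w \<noteq> w'" "a \<noteq> e" "adj v a" "adj v e"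
     "conn (V - {v}) w a" "conn (V - {v}) w' e"
    using step unfolding passable_def by blast
  \<comment> \<open>Follows the holes through the move: the hole \<open>y\<close> is filled and
    reappears at \<open>t p\<close>, joined to \<open>y\<close> by an edge off \<open>v\<close>, so
    each hole keeps its component of the graph without \<open>v\<close>.\<close>
  define \<rho> where "\<rho> = (\<lambda>z. if z = y then t p else z)"
  have \<rho>: "hole u (\<rho> z)" "conn (V - {v}) (\<rho> z) c" if "hole t z" "conn (V - {v}) z c" for z c
  proof -
    show "hole u (\<rho> z)"
      using that p adj_neq[OF p(3)] step by (auto simp: \<rho>_def hole_upd)
    have "conn (V - {v}) (t p) y" using p by (intro conn_edge)
    then show "conn (V - {v}) (\<rho> z) c"
      using that conn_trans unfolding \<rho>_def by fastforce
  qed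
  moreover have "\<rho> w \<noteq> \<rho> w'" using w p by (auto simp: \<rho>_def hole_def)
  ultimately show ?case using w unfolding passable_def by blast
qed (use assms in blast)

lemma passable_second_hole:
  assumes "passable v s" "hole s a" "adj v a"
  obtains w e where "hole s w" "w \<noteq> a" "adj v e" "e \<noteq> a" "conn (far v \<union> {a, e}) w e"
proof -
  \<comment> \<open>If neither of the two given pairs avoids \<open>a\<close>, then \<open>a\<close>
    is one of the holes and also the neighbour assigned to the other hole, and the two links join at
    \<open>a\<close>.\<close>
  have "\<exists>w e. hole s w \<and> w \<noteq> a \<and> adj v e \<and> e \<noteq> a \<and> conn (V - {v}) w e"
    using assms(1) unfolding passable_def by (metis conn_sym conn_trans)
  then obtain w e0 where w: "hole s w" "w \<noteq> a" "adj v e0" "e0 \<noteq> a" "conn (V - {v}) w e0" by blast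
  obtain e where e: "e \<in> nbrs v - {a}" "conn (V - {v} - (nbrs v - {a}) \<union> {e}) w e"
    using conn_first_hit[OF w(5), of "nbrs v - {a}"] w by blast
  have "conn (far v \<union> {a, e}) w e" by (rule conn_mono[OF e(2)]) auto
  with w e that show thesis by blast
qed

lemma passable_two_holes:
  assumes "s \<in> S" "passable v s" "hole s a" "adj v a"
  obtains t e where "reach_in (far v \<union> {a, e}) s t" "adj v e" "e \<noteq> a" "hole t a" "hole t e"
proof -
  obtain w e where w: "hole s w" "w \<noteq> a" "adj v e" "e \<noteq> a" "conn (far v \<union> {a, e}) w e"
    using passable_second_hole assms by metis
  have wX: "w \<in> far v \<union> {a, e}" using conn_mem[OF w(5)] by blast
  obtain t where "reach_in (far v \<union> {a, e}) s t" "hole t a" "hole t e"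
    using shift_hole_keeping[OF assms(1,3) w(1) w(2)[symmetric] _ wX w(5,4)] by blast
  with w that show thesis by blast
qed

text \<open>Any hole reaches some neighbour of \<open>v\<close> off \<open>v\<close>; were it not
  \<open>a\<close>, this hole and \<open>a\<close> itself would witness passability. Likewise a
  second neighbour in the component of \<open>a\<close> would be available to a hole other than
  \<open>a\<close>.\<close>

lemma impassable_holes:
  assumes "s \<in> S" "\<not> passable v s" "v \<in> V" "\<not> hole s v" "hole s a" "adj v a"
  shows "hole s w \<Longrightarrow> conn (V - {v}) a w"
    and "adj v x \<Longrightarrow> conn (V - {v}) a x \<Longrightarrow> x = a"
proof -
  have *: "conn (V - {v}) a w" if w: "hole s w" for w
  proof (cases "w = a")
    case False
    have "w \<noteq> v" using assms w by blast
    then obtain c where c: "adj v c" "conn (V - {v}) w c"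
      using conn_nbr assms hole_V w by metis
    then have "c = a" using assms w False unfolding passable_def by (metis conn_refl)
    with c show ?thesis by (simp add: conn_sym)
  qed simp
  then show "hole s w \<Longrightarrow> conn (V - {v}) a w" .
  assume x: "adj v x" "conn (V - {v}) a x"
  obtain w where w: "hole s w" "w \<noteq> a" using other_hole assms by metis
  have "conn (V - {v}) w x" using * w x conn_sym conn_trans by metis
  then show "x = a" using assms w x unfolding passable_def by (metis conn_refl)
qed

text \<open>Used in contrapositive: a pebble whose range contains \<open>v\<close> and two
  neighbours of \<open>v\<close> is passable there at some time. After a hole has been led to
  \<open>a\<close> with \<open>p\<close> held on \<open>v\<close>, every exit and every return of
  \<open>p\<close> goes through \<open>a\<close>.\<close>

lemma single_nbr_in_range:
  assumes s0: "s0 \<in> S" "p \<in> P" "s0 p = v"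
    and imp: "\<And>s. eqv s0 s \<Longrightarrow> s p = v \<Longrightarrow> \<not> passable v s"
  obtains a where "\<And>s. eqv s0 s \<Longrightarrow> adj v (s p) \<Longrightarrow> s p = a"
proof -
  have vV: "v \<in> V" using s0 S_V by blast
  obtain w where w: "hole s0 w" "w \<noteq> v" using other_hole s0 by metis
  then obtain a where a: "adj v a" "conn (V - {v}) w a"
    using conn_nbr vV hole_V by metis
  obtain s1 where s1: "reach_in (V - {v}) s0 s1" "hole s1 a"
    using shift_hole[OF s0(1) w(1) _ a(2)] w hole_V by blast
  have e1: "eqv s0 s1" using s1 s0 eqv_reach by blast
  have s1p: "s1 p = v" using reach_in_outside s0 s1 by fastforce
  note imp1 = impassable_holes[OF eqvD(2)[OF e1] imp[OF e1 s1p] vV _ s1(2) a(1)]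
  have nh: "\<not> hole s1 v" using s1p s0 hole_neq by blast
  \<comment> \<open>Invariant: either \<open>p\<close> is on \<open>v\<close> with all holes behind
    \<open>a\<close>, or \<open>p\<close> itself is behind \<open>a\<close>, in the component of
    \<open>a\<close> off \<open>v\<close>.\<close>
  have inv: "(s p = v \<and> (\<forall>w. hole s w \<longrightarrow> conn (V - {v}) a w)) \<or> conn (V - {v}) a (s p)"
    if "reach_in V s1 s" for s
    using that eqvD(2)[OF e1]
  proof (induction rule: reach_in_induct)
    case refl
    then show ?case using s1p imp1(1)[OF nh] by blast
  next
    case (step t u)
    obtain q y where q: "q \<in> P" "hole t y" "adj (t q) y" "u = t(q := y)"
      using step by (auto simp: move_in_def)
    consider "t p = v" "\<And>w. hole t w \<Longrightarrow> conn (V - {v}) a w" | "conn (V - {v}) a (t p)"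
      using step.IH by blast
    then show ?case
    proof cases
      case 1
      show ?thesis
      proof (cases "q = p")
        case True
        then show ?thesis using 1 q by auto
      next
        case False
        have "y \<noteq> v" using q s0 1 hole_neq by blast
        moreover have "t q \<noteq> v" using False 1 q s0 step.hyps S_inj by metis
        ultimately have "conn (V - {v}) y (t q)"
          using q adj_V by (intro conn_edge) (auto intro: adj_sym)
        then have "conn (V - {v}) a (t q)" using 1 q conn_trans by blast
        then have "conn (V - {v}) a w" if "hole u w" for w
          using that 1 q hole_upd[OF step.hyps(2) q(1), of y w] by blast
        moreover have "u p = v" using 1 q False by simp
        ultimately show ?thesis by blast
      qed
    next
      case 2
      have tp: "t p \<noteq> v" using conn_mem[OF 2] adj_neq[OF a(1)] by auto
      consider "q \<noteq> p" | "q = p" "y = v" | "q = p" "y \<noteq> v" by blast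
      then show ?thesis
      proof cases
        case 1
        then show ?thesis using 2 q by simp
      next
        case 2
        \<comment> \<open>\<open>p\<close> re-enters \<open>v\<close>. It comes from
          \<open>a\<close>, which is thereby emptied, and by hypothesis the new configuration is
          again impassable, so all holes are behind \<open>a\<close> once more.\<close>
        then have "adj v (t p)" using q by (auto intro: adj_sym)
        then have tpa: "t p = a" using imp1(2)[OF nh] \<open>conn (V - {v}) a (t p)\<close> by blast
        have up: "u p = v" using 2 q by simp
        have "eqv s1 u" using step eqvD(2)[OF e1] unfolding eqv_def
          by (blast intro: reach_in_trans reach_in_move)
        then have "\<not> passable v u" using imp up e1 eqv_trans by blast
        moreover have "hole u a" using q tpa 2 tp step.hyps by (auto simp: hole_upd)
        moreover have "\<not> hole u v" using up s0 hole_neq by blast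
        ultimately show ?thesis using impassable_holes(1) step.hyps vV a up by blast
      next
        case 3
        then have "conn (V - {v}) (t p) y"
          using q tp adj_V by (intro conn_edge) auto
        then show ?thesis using \<open>conn (V - {v}) a (t p)\<close> 3 q conn_trans by auto
      qed
    qed
  qed
  show thesis
  proof (rule that)
    fix s assume s: "eqv s0 s" "adj v (s p)"
    then have "reach_in V s1 s" using e1 eqv_sym eqv_trans eqv_def by blast
    then have "conn (V - {v}) a (s p)" using inv adj_neq[OF s(2)] by blast
    then show "s p = a" using imp1(2)[OF nh] s by blast
  qed
qed

lemma star_exchange_at:
  assumes "eqv T s" "p \<in> P" "q \<in> P" "p \<noteq> q" "s p = v" "adj v (s q)"
    "adj v a" "adj v b" "a \<noteq> b" "hole s a" "hole s b"
  shows "xch T p q"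
proof -
  have "xch s p q" using assms eqvD by (intro star_exchange[of s p q a b]) auto
  then show ?thesis using assms(1) eqv_sym xch_eqv by blast
qed

text \<open>The base of the comparison at an empty \<open>v\<close>: \<open>r2\<close> is one step
  away, whereas \<open>r1\<close> may be far off and is only known to be placeable on
  \<open>v\<close> up to equivalence. When the direct exchange is blocked, a pebble on a third
  neighbour serves as intermediary and \<open>xch_trans\<close> concludes; degree three supplies
  that neighbour.\<close>

lemma exchange_at_vertex:
  assumes T: "T \<in> S" "hole T v" and r: "r1 \<in> P" "r2 \<in> P" "r1 \<noteq> r2"
    and b: "adj v (T r2)" and e1: "eqv T (T(r1 := v))"
    and pass: "passable v (T(r1 := v))" "passable v (T(r2 := v))" and deg: "3 \<le> card (nbrs v)"
  shows "xch T r1 r2"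
proof -
  define b u T1 T2 where "b = T r2" and "u = T r1" and "T1 = T(r1 := v)" and "T2 = T(r2 := v)"
  have vb: "adj v b" using assms by (simp add: b_def)
  have vV: "v \<in> V" using T hole_V by blast
  have eT1: "eqv T T1" using e1 by (simp add: T1_def)
  have eT2: "eqv T T2" unfolding T2_def using T r b by (intro eqv_upd) (auto intro: adj_sym)
  note T1S = eqvD(2)[OF eT1] and T2S = eqvD(2)[OF eT2]
  note pass1 = pass(1)[folded T1_def] and pass2 = pass(2)[folded T2_def]
  have nv: "x \<noteq> v" if "adj v x" for x using that adj_neq by blast
  have T1r: "T1 r1 = v" "T1 r2 = b" and T2r: "T2 r2 = v" "T2 r1 = u"
    using r by (auto simp: T1_def T2_def b_def u_def)
  have T12: "T2 y = T1 y" if "y \<noteq> r1" "y \<noteq> r2" for y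
    using that by (simp add: T1_def T2_def)
  have uv: "u \<noteq> v" using T r hole_neq u_def by blast
  have bv: "b \<noteq> v" using vb nv by blast
  have h1: "hole T1 x \<longleftrightarrow> x = u \<or> hole T x \<and> x \<noteq> v" for x
    using uv T r by (auto simp: T1_def u_def hole_upd)
  have h2: "hole T2 x \<longleftrightarrow> x = b \<or> hole T x \<and> x \<noteq> v" for x
    using bv T r by (auto simp: T2_def b_def hole_upd)
  have ub: "u \<noteq> b" using r T S_inj by (simp add: u_def b_def)
  have nhb: "\<not> hole T b" using r hole_neq b_def by blast
  have nhu: "\<not> hole T u" using r hole_neq u_def by blast
  \<comment> \<open>In \<open>T2\<close> the neighbour \<open>b\<close> has just been vacated, so a
    second hole \<open>w\<close> can be led to some \<open>e\<close> without touching other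
    neighbours. Then \<open>r2\<close> on \<open>v\<close> is exchangeable with any pebble on a
    neighbour other than \<open>b\<close> and \<open>e\<close>.\<close>
  obtain w e where w: "hole T2 w" "w \<noteq> b" "adj v e" "e \<noteq> b" "conn (far v \<union> {b, e}) w e"
    using passable_second_hole[OF pass2 _ vb] h2 by blast
  have w1: "hole T1 w" "w \<noteq> u" "w \<noteq> v" using w h1 h2 nhu by auto
  have wX: "w \<in> far v \<union> {b, e}" using conn_mem[OF w(5)] by blast
  have r2_third: "xch T r2 y" if "y \<in> P" "y \<noteq> r2" "adj v (T2 y)" "T2 y \<noteq> b" "T2 y \<noteq> e" for y
  proof -
    obtain t where t: "reach_in (far v \<union> {b, e}) T2 t" "hole t b" "hole t e"
      using shift_hole_keeping[OF T2S _ w(1) w(2)[symmetric] _ wX w(5,4)] h2 by auto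
    have "t r2 = v" "t y = T2 y"
      using reach_in_outside[OF T2S t(1)] r that T2r nv w(3) vb by auto
    moreover have "eqv T t" using eT2 t T2S eqv_reach eqv_trans by blast
    moreover have "adj v (t y)" using calculation that(3) by simp
    ultimately show ?thesis
      using star_exchange_at[OF _ r(2) that(1) that(2)[symmetric] _ _ vb w(3) w(4)[symmetric] t(2,3)] by blast
  qed
  have occ: "\<exists>y\<in>P. y \<noteq> r1 \<and> y \<noteq> r2 \<and> T1 y = c"
    if c: "\<not> hole T1 c" "adj v c" "c \<noteq> b" for c
  proof -
    obtain y where y: "y \<in> P" "T1 y = c" using not_hole[OF adj_V(2)[OF c(2)]] c(1) by blast
    have "y \<noteq> r1" "y \<noteq> r2" using y T1r nv[OF c(2)] c(3) by auto
    with y show ?thesis by blast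
  qed
  have eT1': "eqv T t" if "reach_in X T1 t" for X t
    using that T1S eT1 eqv_reach eqv_trans by blast
  \<comment> \<open>Split by the number of neighbours of \<open>v\<close> that are empty once
    \<open>r1\<close> stands on \<open>v\<close>. With two, \<open>r1\<close> and \<open>r2\<close>
    are exchanged on the spot; with fewer, holes must be fetched, and this may displace
    \<open>r2\<close> from \<open>b\<close>.\<close>
  consider (two) a a' where "hole T1 a" "hole T1 a'" "adj v a" "adj v a'" "a \<noteq> a'"
    | (one) a where "hole T1 a" "adj v a" "\<And>c. adj v c \<Longrightarrow> hole T1 c \<Longrightarrow> c = a"
    | (none) "\<And>c. adj v c \<Longrightarrow> \<not> hole T1 c"
    by blast
  then show ?thesis
  proof cases
    case two
    have "adj v (T1 r2)" using T1r vb by simp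
    then show ?thesis by (rule star_exchange_at[OF eT1 r T1r(1) _ two(3,4,5,1,2)])
  next
    case one
    have ab: "a \<noteq> b" using one(1) h1[of a] ub nhb by auto
    obtain t e' where t: "reach_in (far v \<union> {a, e'}) T1 t" "adj v e'" "e' \<noteq> a" "hole t a" "hole t e'"
      by (rule passable_two_holes[OF T1S pass1 one(1,2)])
    have tr: "t y = T1 y" if "y \<in> P" "T1 y = v \<or> adj v (T1 y) \<and> T1 y \<noteq> a \<and> T1 y \<noteq> e'" for y
      using reach_in_outside[OF T1S t(1)] that nv t(2) one(2) by auto
    have tr1: "t r1 = v" using tr r T1r by simp
    show ?thesis
    proof (cases "e' = b")
      case False
      then have "adj v (t r2)" using tr r T1r vb ab by simp
      then show ?thesis
        by (rule star_exchange_at[OF eT1'[OF t(1)] r tr1 _ one(2) t(2) t(3)[symmetric] t(4,5)])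
    next
      case True
      obtain c where c: "adj v c" "c \<noteq> a" "c \<noteq> b" by (rule third_nbr[OF deg])
      then obtain y where y: "y \<in> P" "y \<noteq> r1" "y \<noteq> r2" "T1 y = c"
        using occ one by metis
      have "adj v (t y)" using tr y c True by simp
      then have ry: "xch T r1 y"
        by (rule star_exchange_at[OF eT1'[OF t(1)] r(1) y(1) y(2)[symmetric] tr1 _ one(2) t(2)
              t(3)[symmetric] t(4,5)])
      \<comment> \<open>\<open>a\<close> is empty in \<open>T1\<close>, so in \<open>T2\<close> it
        is either still empty or the old place of \<open>r1\<close>. Accordingly \<open>r2\<close>
        is exchanged with \<open>y\<close> over \<open>a\<close> and \<open>b\<close>, or by
        \<open>r2_third\<close> with \<open>r1\<close> on \<open>a\<close>, or with \<open>y\<close>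
        if \<open>e\<close> is \<open>a\<close>.\<close>
      consider "hole T2 a" | "T2 r1 = a" "e \<noteq> a" | "e = a"
        using one h1 h2 T2r by metis
      then show ?thesis
      proof cases
        case 1
        have "hole T2 b" "adj v (T2 y)" using h2 T12 y c by simp_all
        then have "xch T r2 y"
          using star_exchange_at[OF eT2 r(2) y(1) y(3)[symmetric] T2r(1) _ one(2) vb ab 1] by blast
        then show ?thesis using ry xch_sym xch_trans by blast
      next
        case 2
        then show ?thesis using r2_third r one ab xch_sym by metis
      next
        case 3
        then have "xch T r2 y" using r2_third[of y] y c T12 by auto
        then show ?thesis using ry xch_sym xch_trans by blast
      qed
    qed
  next
    case none
    obtain c where c: "adj v c" "c \<noteq> b" "c \<noteq> e" by (rule third_nbr[OF deg])
    then obtain y where y: "y \<in> P" "y \<noteq> r1" "y \<noteq> r2" "T1 y = c"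
      using occ none by metis
    have "xch T r2 y" using r2_third[of y] y c T12 by auto
    then have via_y: ?thesis if "xch T r1 y" using that xch_sym xch_trans by blast
    have wfar: "w \<in> far v" using w1 none hole_V by auto
    have u1: "hole T1 u" using h1 by blast
    have ufar: "u \<in> far v" using u1 uv none hole_V by auto
    \<comment> \<open>A hole led to \<open>e\<close> disturbs no other neighbour, and passability
      survives. If the second hole then arrives at a neighbour other than \<open>b\<close>,
      \<open>r2\<close> is still in place; if it arrives at \<open>b\<close>, the pebble
      \<open>y\<close> on \<open>c\<close> is still in place.\<close>
    have near_e: ?thesis if h: "hole T1 h" "conn (far v \<union> {e}) h e" for h
    proof -
      have hX: "h \<in> far v \<union> {e}" using conn_mem[OF h(2)] by blast
      obtain t0 where t0: "reach_in (far v \<union> {e}) T1 t0" "hole t0 e"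
        by (rule shift_hole[OF T1S h(1) hX h(2)])
      have t0S: "t0 \<in> S" using t0 T1S reach_in_S by blast
      have "far v \<union> {e} \<subseteq> V - {v}" using w(3) nv adj_V by auto
      then have p0: "passable v t0"
        using passable_reach[OF T1S reach_in_mono[OF t0(1)] pass1] by blast
      obtain t e2 where t: "reach_in (far v \<union> {e, e2}) t0 t" "adj v e2" "e2 \<noteq> e" "hole t e" "hole t e2"
        by (rule passable_two_holes[OF t0S p0 t0(2) w(3)])
      have reach: "reach_in (far v \<union> {e, e2}) T1 t"
        by (rule reach_in_trans[OF reach_in_mono[OF t0(1)] t(1)]) auto
      have tr: "t y = T1 y" if "y \<in> P" "T1 y = v \<or> adj v (T1 y) \<and> T1 y \<noteq> e \<and> T1 y \<noteq> e2" for y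
        using reach_in_outside[OF T1S reach] that nv t(2) w(3) by auto
      have tr1: "t r1 = v" using tr r T1r by simp
      show ?thesis
      proof (cases "e2 = b")
        case False
        then have "t r2 = b" using tr r T1r vb w(4) by simp
        then have "adj v (t r2)" using vb by simp
        then show ?thesis
          by (rule star_exchange_at[OF eT1'[OF reach] r tr1 _ w(3) t(2) t(3)[symmetric] t(4,5)])
      next
        case True
        then have "adj v (t y)" using tr y c by simp
        then have "xch T r1 y"
          by (rule star_exchange_at[OF eT1'[OF reach] r(1) y(1) y(2)[symmetric] tr1 _ w(3) t(2)
                t(3)[symmetric] t(4,5)])
        then show ?thesis by (rule via_y)
      qed
    qed
    obtain d0 where d0: "adj v d0" "conn (V - {v}) u d0"
      by (rule conn_nbr[OF vV hole_V[OF u1] uv])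
    obtain d where d: "adj v d" "conn (far v \<union> {d}) u d"
      using conn_first_hit[OF d0(2), of "nbrs v"] d0(1) by auto
    have wd: "w \<noteq> d" using d none w1 by blast
    consider "d = e" | "d = b" | "d \<noteq> e" "d \<noteq> b" by blast
    then show ?thesis
    proof cases
      case 1
      then show ?thesis using near_e u1 d by blast
    next
      case 2
      obtain d' where d': "d' \<in> {b, e}" "conn (far v \<union> {b, e} - {b, e} \<union> {d'}) w d'"
        using conn_first_hit[OF w(5), of "{b, e}"] by blast
      have wd': "conn (far v \<union> {d'}) w d'" by (rule conn_mono[OF d'(2)]) auto
      show ?thesis
      proof (cases "d' = e")
        case True
        then show ?thesis using near_e w1 wd' by blast
      next
        case False
        have "far v \<union> {b} \<subseteq> far v \<union> {b, e}" by auto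
        then have ub': "conn (far v \<union> {b, e}) u b" using 2 d conn_mono by blast
        obtain t0 where t0: "reach_in (far v \<union> {b, e}) T1 t0" "hole t0 w" "hole t0 b"
          by (rule shift_hole_keeping[OF T1S w1(1) u1 w1(2) wX _ ub' w(2)[symmetric]])
            (use ufar in blast)
        have t0S: "t0 \<in> S" using t0 T1S reach_in_S by blast
        obtain t where t: "reach_in (far v \<union> {b, e}) t0 t" "hole t b" "hole t e"
          by (rule shift_hole_keeping[OF t0S t0(3,2) w(2)[symmetric] _ wX w(5,4)]) simp
        have reach: "reach_in (far v \<union> {b, e}) T1 t" by (rule reach_in_trans[OF t0(1) t(1)])
        have ty: "t r1 = v" "t y = c"
          using reach_in_outside[OF T1S reach r(1)] reach_in_outside[OF T1S reach y(1)]
            T1r(1) y(4) c nv[OF w(3)] bv by simp_all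
        have "adj v (t y)" using ty c by simp
        then have "xch T r1 y"
          by (rule star_exchange_at[OF eT1'[OF reach] r(1) y(1) y(2)[symmetric] ty(1) _ vb w(3)
                w(4)[symmetric] t(2,3)])
        then show ?thesis by (rule via_y)
      qed
    next
      case 3
      \<comment> \<open>Here \<open>u\<close> opens a neighbour \<open>d\<close> away from
        \<open>b\<close> and \<open>e\<close>. \<open>r1\<close> steps from \<open>v\<close> to
        \<open>d\<close> and \<open>r2\<close> from \<open>b\<close> to \<open>v\<close>; then
        \<open>w\<close> is led to \<open>e\<close> with \<open>b\<close> kept empty, and the star
        exchange is done with \<open>r2\<close> in the centre.\<close>
      obtain t0 where t0: "reach_in (far v \<union> {d}) T1 t0" "hole t0 w" "hole t0 d"
        by (rule shift_hole_keeping[OF T1S w1(1) u1 w1(2) _ _ d(2) wd[symmetric]])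
          (use wfar ufar in blast)+
      have t0S: "t0 \<in> S" using t0 T1S reach_in_S by blast
      have t0r: "t0 r1 = v" "t0 r2 = b"
        using reach_in_outside[OF T1S t0(1) r(1)] reach_in_outside[OF T1S t0(1) r(2)]
          T1r nv[OF d(1)] vb 3 by simp_all
      define t1 where "t1 = t0(r1 := d)"
      have t1: "eqv t0 t1" unfolding t1_def using t0S r t0 t0r d by (intro eqv_upd) auto
      have h1': "hole t1 x \<longleftrightarrow> x = v \<or> hole t0 x \<and> x \<noteq> d" for x
        using hole_upd[OF t0S r(1), of d x] t0r d nv by (auto simp: t1_def)
      have t1r: "t1 r1 = d" "t1 r2 = b" using t0r r by (auto simp: t1_def)
      define t2 where "t2 = t1(r2 := v)"
      note t1S = eqvD(2)[OF t1]
      have t2: "eqv t1 t2" unfolding t2_def using t1S r t1r h1' vb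
        by (intro eqv_upd) (auto intro: adj_sym)
      have h2': "hole t2 x \<longleftrightarrow> x = b \<or> hole t1 x \<and> x \<noteq> v" for x
        using hole_upd[OF t1S r(2), of v x] t1r bv by (auto simp: t2_def)
      have t2r: "t2 r1 = d" "t2 r2 = v" using t1r r by (auto simp: t2_def)
      note t2S = eqvD(2)[OF t2]
      have h2bw: "hole t2 b" "hole t2 w" using h1' h2' t0 wd w1 by auto
      obtain t where t: "reach_in (far v \<union> {b, e}) t2 t" "hole t b" "hole t e"
        by (rule shift_hole_keeping[OF t2S h2bw w(2)[symmetric] _ wX w(5,4)]) simp
      have tr: "t r1 = d" "t r2 = v"
        using reach_in_outside[OF t2S t(1) r(1)] reach_in_outside[OF t2S t(1) r(2)]
          t2r nv[OF w(3)] bv d(1) 3 by simp_all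
      have "eqv T t" using eT1'[OF t0(1)] t1 t2 eqv_reach[OF t2S t(1)] eqv_trans by blast
      moreover have "adj v (t r1)" using tr d by simp
      ultimately have "xch T r2 r1"
        using star_exchange_at[OF _ r(2,1) r(3)[symmetric] tr(2) _ vb w(3) w(4)[symmetric] t(2,3)] by blast
      then show ?thesis by (rule xch_sym)
    qed
  qed
qed

text \<open>
  An invariant under moves, for an exchangeability class \<open>W\<close> of pebbles. When \<open>v\<close> is empty, some
  member of \<open>W\<close> could be put there in a passable way. When the pebble on \<open>v\<close> is stuck, all holes
  lie behind one neighbour \<open>b\<close>, and a member of \<open>W\<close> waits, immobile, on another neighbour.
\<close>

definition class_at :: "'v \<Rightarrow> ('p \<Rightarrow> bool) \<Rightarrow> ('p \<Rightarrow> 'v) \<Rightarrow> bool" where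
  "class_at v W s \<longleftrightarrow>
    (\<exists>r\<in>P. s r = v \<and> passable v s \<and> W r) \<or>
    (hole s v \<and> (\<exists>r\<in>P. W r \<and> eqv s (s(r := v)) \<and> passable v (s(r := v)))) \<or>
    (\<exists>y\<in>P. s y = v \<and> \<not> passable v s \<and>
      (\<exists>b c z. adj v b \<and> adj v c \<and> c \<noteq> b \<and> z \<in> P \<and> s z = c \<and> W z \<and>
        (\<forall>x. adj v x \<longrightarrow> conn (V - {v}) b x \<longrightarrow> x = b) \<and>
        (\<forall>w. hole s w \<longrightarrow> conn (V - {v}) b w)))"

text \<open>With \<open>q\<close> stuck on \<open>v\<close>, all holes are behind its old place
  \<open>b\<close>; but the hole left by \<open>r\<close> in \<open>T1\<close> is not, so it opens
  another neighbour \<open>d\<close>. Holes at \<open>b\<close> and \<open>d\<close> let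
  \<open>r\<close> be exchanged with the pebble on a third neighbour, and this pebble represents the
  class.\<close>

lemma class_at_stuck:
  assumes T: "T \<in> S" "hole T v" and r: "r \<in> P" "q \<in> P"
    and b: "adj v (T q)" and e1: "eqv T (T(r := v))"
    and pass: "passable v (T(r := v))" "\<not> passable v (T(q := v))" and deg: "3 \<le> card (nbrs v)"
  obtains c z where "adj v c" "c \<noteq> T q" "z \<in> P" "z \<noteq> q" "T z = c" "xch T r z"
    "\<And>x. adj v x \<Longrightarrow> conn (V - {v}) (T q) x \<Longrightarrow> x = T q"
    "\<And>w. hole (T(q := v)) w \<Longrightarrow> conn (V - {v}) (T q) w"
proof -
  define b u T1 U where "b = T q" and "u = T r" and "T1 = T(r := v)" and "U = T(q := v)"
  have vb: "adj v b" using assms by (simp add: b_def)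
  have vV: "v \<in> V" using T hole_V by blast
  have rq: "r \<noteq> q" using pass by auto
  have eT1: "eqv T T1" using e1 by (simp add: T1_def)
  have eU: "eqv T U" unfolding U_def using T r b by (intro eqv_upd) (auto intro: adj_sym)
  note T1S = eqvD(2)[OF eT1] and US = eqvD(2)[OF eU]
  have nv: "x \<noteq> v" if "adj v x" for x using that adj_neq by blast
  have uv: "u \<noteq> v" using T r hole_neq u_def by blast
  have bv: "b \<noteq> v" using vb nv by blast
  have h1: "hole T1 x \<longleftrightarrow> x = u \<or> hole T x \<and> x \<noteq> v" for x
    using uv hole_upd[OF T(1) r(1), of v x] by (auto simp: T1_def u_def)
  have hU: "hole U x \<longleftrightarrow> x = b \<or> hole T x \<and> x \<noteq> v" for x
    using bv hole_upd[OF T(1) r(2), of v x] by (auto simp: U_def b_def)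
  have Ub: "hole U b" and Uv: "\<not> hole U v" using hU bv by auto
  have uniq: "x = b" if "adj v x" "conn (V - {v}) b x" for x
    by (rule impassable_holes(2)[OF US pass(2)[folded U_def] vV Uv Ub vb that])
  have holes_b: "conn (V - {v}) b x" if "hole U x" for x
    by (rule impassable_holes(1)[OF US pass(2)[folded U_def] vV Uv Ub vb that])
  \<comment> \<open>Otherwise every hole of \<open>T1\<close> would lie behind \<open>b\<close>, the
    only neighbour of \<open>v\<close> in its component, against passability of
    \<open>T1\<close>.\<close>
  have not_ub: "\<not> conn (V - {v}) b u"
  proof
    assume "conn (V - {v}) b u"
    then have *: "conn (V - {v}) b x" if "hole T1 x" for x
      using that holes_b h1[of x] hU[of x] by auto
    obtain w w' a e where "hole T1 w" "hole T1 w'" "a \<noteq> e" "adj v a" "adj v e"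
       "conn (V - {v}) w a" "conn (V - {v}) w' e"
      using pass(1) unfolding passable_def T1_def by blast
    then show False using uniq[of a] uniq[of e] conn_trans[OF *] by auto
  qed
  have u1: "hole T1 u" using h1 by simp
  obtain d0 where d0: "adj v d0" "conn (V - {v}) u d0"
    by (rule conn_nbr[OF vV hole_V[OF u1] uv])
  obtain d where d: "adj v d" "conn (far v \<union> {d}) u d"
    using conn_first_hit[OF d0(2), of "nbrs v"] d0(1) by auto
  have "far v \<union> {d} \<subseteq> V - {v}" using nv[OF d(1)] adj_V(2)[OF d(1)] by auto
  then have db: "d \<noteq> b" using not_ub conn_sym[OF conn_mono[OF d(2)]] by blast
  obtain w where w: "hole T1 w" "w \<noteq> u" by (rule other_hole[OF T1S])
  have wT: "hole T w" "w \<noteq> v" using w h1 by auto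
  have wb: "w \<noteq> b" using wT hole_neq[OF _ r(2)] b_def by blast
  have cbw: "conn (V - {v}) b w" using holes_b hU wT by blast
  obtain d' where d': "d' \<in> nbrs v" "conn (V - {v} - nbrs v \<union> {d'}) w d'"
    by (rule conn_first_hit[OF conn_sym[OF cbw], of "nbrs v"]) (use vb in auto)
  have "far v \<union> {d'} \<subseteq> V - {v}" using d'(1) nv adj_V by auto
  then have "conn (V - {v}) w d'" using conn_mono[OF d'(2)] by blast
  then have d'b: "d' = b" using uniq d'(1) conn_trans[OF cbw] by blast
  have cwb: "conn (far v \<union> {d, b}) w b" by (rule conn_mono[OF d'(2)[unfolded d'b]]) auto
  have cud: "conn (far v \<union> {d, b}) u d" by (rule conn_mono[OF d(2)]) auto
  have nwv: "\<not> adj v w" using uniq cbw wb by blast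
  have wX: "w \<in> far v \<union> {d, b}" using nwv wT hole_V by auto
  have uX: "u \<in> far v \<union> {d, b}" using conn_mem[OF d(2)] by auto
  have wd: "d \<noteq> w" using nwv d by blast
  obtain t0 where t0: "reach_in (far v \<union> {d, b}) T1 t0" "hole t0 w" "hole t0 d"
    by (rule shift_hole_keeping[OF T1S w(1) u1 w(2) wX uX cud wd])
  obtain t where t: "reach_in (far v \<union> {d, b}) t0 t" "hole t d" "hole t b"
    by (rule shift_hole_keeping[OF reach_in_S[OF T1S t0(1)] t0(3,2) wd _ wX cwb db[symmetric]]) simp
  have reach: "reach_in (far v \<union> {d, b}) T1 t" by (rule reach_in_trans[OF t0(1) t(1)])
  obtain c where c: "adj v c" "c \<noteq> d" "c \<noteq> b" by (rule third_nbr[OF deg])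
  have "c \<noteq> u" using conn_mem[OF d(2)] c by auto
  moreover have "\<not> hole T c"
    using uniq[OF c(1)] holes_b[of c] hU[of c] nv[OF c(1)] c(3) by blast
  ultimately have "\<not> hole T1 c" using h1 by blast
  then obtain z where z: "z \<in> P" "T1 z = c" using not_hole[OF adj_V(2)[OF c(1)]] by blast
  have zr: "z \<noteq> r" using z nv[OF c(1)] by (auto simp: T1_def)
  then have Tz: "T z = c" using z by (simp add: T1_def)
  have T1r: "T1 r = v" by (simp add: T1_def)
  have tr: "t r = v" "t z = c"
    using reach_in_outside[OF T1S reach r(1)] reach_in_outside[OF T1S reach z(1)]
      T1r z(2) c nv[OF d(1)] bv by simp_all
  have "eqv T t" using eT1 eqv_reach[OF T1S reach] eqv_trans by blast
  moreover have "adj v (t z)" using tr c by simp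
  ultimately have "xch T r z"
    using star_exchange_at[OF _ r(1) z(1) zr[symmetric] tr(1) _ d(1) vb db t(2,3)] by blast
  moreover have "z \<noteq> q" using Tz c by (auto simp: b_def)
  ultimately show thesis
    using that[of c z] c z Tz uniq holes_b by (simp add: b_def U_def)
qed

text \<open>\<open>W\<close> is only assumed closed under exchange. The critical moves are those
  into an empty \<open>v\<close>, where \<open>exchange_at_vertex\<close> or
  \<open>class_at_stuck\<close> applies, and those of a stuck pebble leaving
  \<open>v\<close>.\<close>

lemma class_at_step:
  assumes t: "t \<in> S" "move_in V t u" and deg: "3 \<le> card (nbrs v)"
    and W: "\<And>r r'. W r \<Longrightarrow> xch t r r' \<Longrightarrow> W r'" and inv: "class_at v W t"
  shows "class_at v W u"
proof -
  obtain q y where q: "q \<in> P" "hole t y" "adj (t q) y" "u = t(q := y)"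
    using t by (auto simp: move_in_def)
  have uS: "u \<in> S" using t move_in_S by blast
  have etu: "eqv t u" using t uS by (auto simp: eqv_def intro: reach_in_move)
  have hu: "hole u x \<longleftrightarrow> x = t q \<or> hole t x \<and> x \<noteq> y" for x
    using hole_upd[OF t(1) q(1), of y x] adj_neq[OF q(3)] q(4) by auto
  have other: "passable v u \<longleftrightarrow> passable v t" "u s = v" if s: "s \<in> P" "t s = v" "s \<noteq> q" for s
  proof -
    have "t q \<noteq> v" "y \<noteq> v" using s q t S_inj hole_neq by blast+
    then have "move_in (V - {v}) t u"
      unfolding move_in_def using q adj_V by blast
    then show "passable v u \<longleftrightarrow> passable v t"
      using passable_reach reach_in_move reach_in_sym t uS by metis
    show "u s = v" using s q by simp
  qed
  consider (in_class) r where "r \<in> P" "t r = v" "passable v t" "W r"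
    | (empty) r where "hole t v" "r \<in> P" "W r" "eqv t (t(r := v))" "passable v (t(r := v))"
    | (stuck) s b c z where "s \<in> P" "t s = v" "\<not> passable v t" "adj v b" "adj v c" "c \<noteq> b" "z \<in> P"
        "t z = c" "W z" "\<And>x. adj v x \<Longrightarrow> conn (V - {v}) b x \<Longrightarrow> x = b"
        "\<And>w. hole t w \<Longrightarrow> conn (V - {v}) b w"
    using inv unfolding class_at_def by blast
  then show ?thesis
  proof cases
    case in_class
    show ?thesis
    proof (cases "q = r")
      case True
      have "u(r := v) = t" using True q in_class by (auto simp: fun_eq_iff)
      moreover have "hole u v" using hu True in_class by blast
      ultimately show ?thesis
        unfolding class_at_def using in_class etu eqv_sym by metis
    next
      case False
      then show ?thesis unfolding class_at_def using other[of r] in_class by auto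
    qed
  next
    case empty
    have tqv: "t q \<noteq> v" using empty q hole_neq by blast
    show ?thesis
    proof (cases "y = v")
      case True
      have b: "adj v (t q)" using q True by (auto intro: adj_sym)
      have uq: "u = t(q := v)" "u q = v" using q True by auto
      show ?thesis
      proof (cases "passable v u")
        case True
        have "W q"
        proof (cases "q = r")
          case False
          have "xch t r q"
            by (rule exchange_at_vertex[OF t(1) empty(1) empty(2) q(1) False[symmetric] b empty(4,5)
                  True[unfolded uq(1)] deg])
          then show ?thesis using W empty by blast
        qed (use empty in simp)
        then show ?thesis unfolding class_at_def using True uq q by blast
      next
        case False
        obtain c z where *: "adj v c" "c \<noteq> t q" "z \<in> P" "z \<noteq> q" "t z = c" "xch t r z"
          "\<And>x. adj v x \<Longrightarrow> conn (V - {v}) (t q) x \<Longrightarrow> x = t q"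
          "\<And>w. hole (t(q := v)) w \<Longrightarrow> conn (V - {v}) (t q) w"
          by (rule class_at_stuck[OF t(1) empty(1) empty(2) q(1) b empty(4,5) False[unfolded uq(1)] deg])
             blast
        have "W z" using W empty * by blast
        moreover have "u z = c" using * q by simp
        ultimately show ?thesis
          unfolding class_at_def using False uq q(1) b * by metis
      qed
    next
      case False
      have huv: "hole u v" using hu False empty by blast
      have "eqv u (u(r := v)) \<and> passable v (u(r := v))"
      proof (cases "q = r")
        case True
        then have "u(r := v) = t(r := v)" using q by (auto simp: fun_eq_iff)
        then show ?thesis using etu empty eqv_sym eqv_trans by metis
      next
        case qr: False
        let ?t = "t(r := v)"
        have tS: "?t \<in> S" using empty eqvD by blast
        have "hole ?t y" using hole_upd[OF t(1) empty(2), of v y] False q by blast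
        then have "move_in (V - {v}) ?t (?t(q := y))"
          unfolding move_in_def using q qr tqv False adj_V[OF q(3)]
          by (intro bexI[of _ q] exI[of _ y]) auto
        moreover have "?t(q := y) = u(r := v)" using qr q by (auto simp: fun_eq_iff)
        ultimately have "reach_in (V - {v}) ?t (u(r := v))" by (simp add: reach_in_move)
        then have "eqv ?t (u(r := v))" "passable v (u(r := v))"
          using tS empty eqv_reach passable_reach by blast+
        then show ?thesis using etu empty eqv_sym eqv_trans by blast
      qed
      then show ?thesis unfolding class_at_def using huv empty by blast
    qed
  next
    case stuck
    have bv: "b \<noteq> v" and cv: "c \<noteq> v" using stuck adj_neq by blast+
    show ?thesis
    proof (cases "q = s")
      case True
      \<comment> \<open>The stuck pebble can leave only to \<open>b\<close>. Then \<open>z\<close>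
        may step from \<open>c\<close> to \<open>v\<close>, and this is passable: \<open>c\<close>
        is empty, and a further hole \<open>w\<close> is linked to \<open>b\<close>.\<close>
      have "y = b" using stuck q True by auto
      have zq: "z \<noteq> q" using True stuck cv by auto
      then have uz: "u z = c" using q stuck by simp
      have huv: "hole u v" using hu True stuck by blast
      have e: "eqv u (u(z := v))"
        by (rule eqv_upd[OF uS _ huv]) (use stuck uz in \<open>auto intro: adj_sym\<close>)
      have hz: "hole (u(z := v)) x \<longleftrightarrow> x = c \<or> hole u x \<and> x \<noteq> v" for x
        using hole_upd[OF uS stuck(7), of v x] uz cv by auto
      obtain w where w: "hole t w" "w \<noteq> b" by (rule other_hole[OF t(1)])
      have "w \<noteq> v" "w \<noteq> c" using w stuck hole_neq by blast+
      then have "hole (u(z := v)) w" using hz hu w \<open>y = b\<close> by blast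
      moreover have "hole (u(z := v)) c" using hz by blast
      moreover have "conn (V - {v}) w b" using stuck w conn_sym by blast
      ultimately have "passable v (u(z := v))"
        unfolding passable_def using stuck(4,5,6) \<open>w \<noteq> c\<close> conn_refl by metis
      then show ?thesis unfolding class_at_def using huv stuck e by blast
    next
      case False
      have "t q \<noteq> v" "y \<noteq> v" using False stuck q t S_inj hole_neq by blast+
      \<comment> \<open>The moving pebble starts and ends behind \<open>b\<close>, whereas
        \<open>z\<close> sits on a different neighbour, hence not behind \<open>b\<close>; so
        \<open>z\<close> is not the one that moves.\<close>
      then have "conn (V - {v}) y (t q)"
        using q adj_V by (intro conn_edge) (auto intro: adj_sym)
      then have bq: "conn (V - {v}) b (t q)" using stuck q conn_trans by blast
      then have "q \<noteq> z" using stuck by blast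
      then have "u z = c" using q stuck by simp
      moreover have "conn (V - {v}) b w" if "hole u w" for w
        using that hu[of w] bq stuck(11)[of w] by auto
      moreover have "\<not> passable v u" "u s = v" using other[of s] False stuck by auto
      ultimately show ?thesis unfolding class_at_def using stuck by blast
    qed
  qed
qed

text \<open>Run the invariant with the class of \<open>r0\<close>. At \<open>s\<close> the vertex
  \<open>v\<close> is occupied and passable, which leaves only the first alternative of
  \<open>class_at\<close>.\<close>

lemma passable_pebbles_exchangeable:
  assumes deg: "3 \<le> card (nbrs v)" and s0: "r0 \<in> P" "s0 r0 = v" "passable v s0"
    and s: "eqv s0 s" "r \<in> P" "s r = v" "passable v s"
  shows "xch s0 r0 r"
proof -
  have S0: "s0 \<in> S" "reach_in V s0 s" using s by (auto simp: eqv_def)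
  from this(2,1) have "eqv s0 s \<and> class_at v (xch s0 r0) s"
  proof (induction rule: reach_in_induct)
    case refl
    have "class_at v (xch s0 r0) s0"
      unfolding class_at_def using s0 S0 xch_refl by blast
    then show ?case using S0 eqv_refl by blast
  next
    case (step t u)
    have "eqv t u" using step by (auto simp: eqv_def intro: reach_in_move)
    moreover have "class_at v (xch s0 r0) u"
    proof (rule class_at_step[OF step.hyps(2,3) deg])
      show "xch s0 r0 r'" if "xch s0 r0 r" "xch t r r'" for r r'
        using that step.IH eqv_sym xch_eqv xch_trans by blast
    qed (use step in blast)
    ultimately show ?case using step eqv_trans by blast
  qed
  moreover have "\<not> hole s v" using s hole_neq by blast
  moreover have "r' = r" if "r' \<in> P" "s r' = v" for r'
    using that s eqvD S_inj by metis
  ultimately show ?thesis using s unfolding class_at_def by blast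
qed

section \<open>Equal ranges\<close>

lemma three_nbrs:
  assumes "adj v a" "adj v b" "adj v c" "a \<noteq> b" "a \<noteq> c" "b \<noteq> c"
  shows "3 \<le> card (nbrs v)"
proof -
  have "card {a, b, c} = 3" using assms by simp
  then show ?thesis using card_mono[OF finite_nbrs, of "{a, b, c}" v] assms by simp
qed

text \<open>In a longest path both neighbours of the last vertex lie on the path, and the earlier
  one must be the first vertex. The path thus closes up, and by connectedness nothing lies outside
  it.\<close>

lemma two_regular_is_cycle:
  assumes two: "\<And>v. v \<in> V \<Longrightarrow> card (nbrs v) = 2"
  shows "is_cycle_graph G"
proof -
  define path where "path vs \<longleftrightarrow> vs \<noteq> [] \<and> distinct vs \<and> set vs \<subseteq> V \<and>
    (\<forall>i. Suc i < length vs \<longrightarrow> adj (vs ! i) (vs ! Suc i))" for vs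
  have bound: "length vs < Suc (card V)" if "path vs" for vs
    using that pair_finite_verts unfolding path_def
    by (metis card_mono distinct_card less_Suc_eq_le)
  have "V \<noteq> {}" using two_holes by auto
  then obtain v0 where "v0 \<in> V" by blast
  then have "path [v0]" by (simp add: path_def)
  then obtain vs where vs: "path vs" "\<And>ws. path ws \<Longrightarrow> length ws \<le> length vs"
    using ex_has_greatest_nat[of path "[v0]" length] bound by blast
  define n where "n = length vs"
  have n0: "n > 0" using vs by (simp add: n_def path_def)
  have inV: "vs ! i \<in> V" if "i < n" for i using vs that by (auto simp: path_def n_def)
  have succ: "adj (vs ! i) (vs ! Suc i)" if "Suc i < n" for i
    using vs that by (auto simp: path_def n_def)
  have inj: "vs ! i = vs ! j \<longleftrightarrow> i = j" if "i < n" "j < n" for i j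
    using vs that by (auto simp: path_def n_def nth_eq_iff_index_eq)
  have in_path: "x \<in> set vs" if x: "adj (vs ! (n - 1)) x" for x
  proof (rule ccontr)
    assume "x \<notin> set vs"
    have "adj ((vs @ [x]) ! i) ((vs @ [x]) ! Suc i)" if "Suc i < length (vs @ [x])" for i
    proof (cases "Suc i < n")
      case True
      then show ?thesis using succ by (simp add: nth_append n_def)
    next
      case False
      then have "i = n - 1" using that by (simp add: n_def)
      then show ?thesis using x n0 by (simp add: nth_append n_def)
    qed
    then have "path (vs @ [x])"
      using vs \<open>x \<notin> set vs\<close> x adj_V by (auto simp: path_def)
    then show False using vs(2) by fastforce
  qed
  have "card (nbrs (vs ! (n - 1))) = 2" using two inV n0 by simp
  then obtain a a' where aa: "nbrs (vs ! (n - 1)) = {a, a'}" "a \<noteq> a'" by (auto simp: card_2_iff)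
  have "\<exists>i j. i < j \<and> j < n - 1 \<and> adj (vs ! (n - 1)) (vs ! i)"
  proof -
    have "\<exists>k. k < n - 1 \<and> vs ! k = x" if x: "adj (vs ! (n - 1)) x" for x
    proof -
      obtain k where k: "k < n" "vs ! k = x" using in_path[OF x] by (auto simp: in_set_conv_nth n_def)
      then have "k \<noteq> n - 1" using adj_neq[OF x] by auto
      then show ?thesis using k by (intro exI[of _ k]) auto
    qed
    moreover have adj: "adj (vs ! (n - 1)) a" "adj (vs ! (n - 1)) a'" using aa by auto
    ultimately obtain i j where "i < n - 1" "vs ! i = a" "j < n - 1" "vs ! j = a'" by blast
    moreover from this have "i < j \<or> j < i" using aa(2) by (metis nat_neq_iff)
    ultimately show ?thesis using adj by blast
  qed
  then obtain i j where ij: "i < j" "j < n - 1" "adj (vs ! (n - 1)) (vs ! i)" by blast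
  \<comment> \<open>The second neighbour, at \<open>j\<close>, guarantees
    \<open>Suc i < n - 1\<close>; so for \<open>i > 0\<close> the vertices at \<open>i - 1\<close>,
    \<open>Suc i\<close> and \<open>n - 1\<close> would be three different neighbours of
    \<open>vs ! i\<close>. It also yields \<open>n \<ge> 3\<close>.\<close>
  have "i = 0"
  proof (rule ccontr)
    assume "i \<noteq> 0"
    then obtain h where h: "i = Suc h" by (cases i) auto
    have lt: "h < n" "Suc i < n" "n - 1 < n" "i < n" using ij h by auto
    have "adj (vs ! i) (vs ! h)" "adj (vs ! i) (vs ! Suc i)" "adj (vs ! i) (vs ! (n - 1))"
      using succ[of h] succ[of i] ij(3) lt h by (auto intro: adj_sym)
    moreover have "vs ! h \<noteq> vs ! Suc i" "vs ! h \<noteq> vs ! (n - 1)" "vs ! Suc i \<noteq> vs ! (n - 1)"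
      unfolding inj[OF lt(1,2)] inj[OF lt(1,3)] inj[OF lt(2,3)] using ij h by simp_all
    ultimately have "3 \<le> card (nbrs (vs ! i))" by (rule three_nbrs)
    then show False using two[OF inV[OF lt(4)]] by simp
  qed
  then have n3: "3 \<le> n" and closing: "adj (vs ! (n - 1)) (vs ! 0)" using ij by auto
  \<comment> \<open>Cyclic predecessor. It differs from the successor because
    \<open>n \<ge> 3\<close>, so the two exhaust the neighbourhood.\<close>
  define pre where "pre i = (if i = 0 then n - 1 else i - 1)" for i
  have csucc: "adj (vs ! i) (vs ! (Suc i mod n))" if "i < n" for i
  proof (cases "Suc i < n")
    case False
    then have "i = n - 1" using that by simp
    then show ?thesis using closing n3 by simp
  qed (use succ in simp)
  have pre: "pre i < n" "Suc (pre i) mod n = i" "pre i \<noteq> Suc i mod n" if "i < n" for i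
    using that n3 by (auto simp: pre_def mod_Suc)
  have nbrs_vs: "nbrs (vs ! i) = {vs ! (Suc i mod n), vs ! pre i}" if i: "i < n" for i
  proof (rule card_subset_eq[OF finite_nbrs, symmetric])
    show "{vs ! (Suc i mod n), vs ! pre i} \<subseteq> nbrs (vs ! i)"
      using csucc[OF i] csucc[OF pre(1)[OF i]] pre(2)[OF i] by (auto intro: adj_sym)
    have "vs ! (Suc i mod n) \<noteq> vs ! pre i"
      using inj[of "Suc i mod n" "pre i"] pre[OF i] n0 by simp
    then show "card {vs ! (Suc i mod n), vs ! pre i} = card (nbrs (vs ! i))"
      using two inV i by simp
  qed
  have "V \<subseteq> set vs"
  proof
    fix x assume "x \<in> V"
    then have "conn V (vs ! 0) x" using conn_V inV n0 by blast
    then show "x \<in> set vs"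
    proof (induction rule: conn_induct)
      case refl
      then show ?case using n0 by (simp add: n_def)
    next
      case (step y z)
      then obtain i where "i < n" "vs ! i = y" by (auto simp: in_set_conv_nth n_def)
      then have "z = vs ! (Suc i mod n) \<or> z = vs ! pre i" using nbrs_vs step by blast
      then show ?case using \<open>i < n\<close> pre n0 by (auto simp: n_def)
    qed
  qed
  then have "set vs = V" using vs by (auto simp: path_def)
  moreover have "adj (vs ! i) (vs ! j) \<longleftrightarrow> j = Suc i mod n \<or> i = Suc j mod n"
    if "i < n" "j < n" for i j
  proof
    assume "adj (vs ! i) (vs ! j)"
    then have "vs ! j = vs ! (Suc i mod n) \<or> vs ! j = vs ! pre i" using nbrs_vs[OF that(1)] by blast
    then have "j = Suc i mod n \<or> j = pre i" using inj that pre n0 by simp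
    then show "j = Suc i mod n \<or> i = Suc j mod n" using pre that by auto
  next
    assume "j = Suc i mod n \<or> i = Suc j mod n"
    then show "adj (vs ! i) (vs ! j)" using csucc that adj_sym by blast
  qed
  ultimately have "cyclic_listing G vs"
    using n3 vs by (simp add: cyclic_listing_def path_def n_def)
  then show ?thesis by (auto simp: is_cycle_graph_def)
qed

lemma reachable_range_eq: "reachable_range P G p f = {h p | h. eqv f h}"
  unfolding reachable_range_def pebble_equiv_eq using eqv_sym by blast

text \<open>
  Where no vertex of the common range \<open>D\<close> branches inside \<open>D\<close>, \<open>D\<close> is a path, and two pebbles
  confined to a path cannot get past each other: \<open>p\<close> keeps separating \<open>q\<close> from the end \<open>d\<close>.
\<close>

lemma separation_from_end:
  assumes s: "s \<in> S" "p \<in> P" "q \<in> P" "p \<noteq> q"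
    and D: "\<And>t. eqv s t \<Longrightarrow> t p \<in> D" "\<And>t. eqv s t \<Longrightarrow> t q \<in> D"
    and branch: "\<And>x a b c. x \<in> D \<Longrightarrow> a \<in> D \<Longrightarrow> b \<in> D \<Longrightarrow> adj x a \<Longrightarrow> adj x b \<Longrightarrow> adj x c \<Longrightarrow>
      a \<noteq> b \<Longrightarrow> a \<noteq> c \<Longrightarrow> b \<noteq> c \<Longrightarrow> False"
    and d: "\<And>a b. a \<in> D \<Longrightarrow> b \<in> D \<Longrightarrow> adj d a \<Longrightarrow> adj d b \<Longrightarrow> a = b"
    and sp: "s p = d" and t: "eqv s t"
  shows "t q \<noteq> d"
proof -
  have keep: "conn (D - {x}) d w"
    if x: "x \<in> D" "x' \<in> D" "adj x x'" and w: "conn (D - {x'}) d w" "w \<noteq> x" for x x' w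
  proof -
    have "(w \<noteq> x \<longrightarrow> conn (D - {x}) d w) \<and>
      (w = x \<longrightarrow> x = d \<or> (\<exists>z\<in>D - {x'}. adj x z \<and> conn (D - {x}) d z))"
      using w(1)
    proof (induction rule: conn_induct)
      case refl
      then show ?case by simp
    next
      case (step w w')
      consider "w \<noteq> x" "w' \<noteq> x" | "w \<noteq> x" "w' = x" | "w = x" "w' \<noteq> x"
        using adj_neq[OF step.hyps(2)] by blast
      then show ?case
      proof cases
        case 1
        then show ?thesis using step by (auto intro: conn_step)
      next
        case 2
        then show ?thesis using step adj_sym by blast
      next
        case 3
        have xw: "adj x w'" "w' \<in> D" "w' \<noteq> x'" using 3 step by auto
        have "x \<noteq> d" using d[of w' x'] x xw by blast
        then obtain z where z: "z \<in> D - {x'}" "adj x z" "conn (D - {x}) d z" using 3 step.IH by blast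
        have "w' = z" using branch[of x z w' x'] x xw z by blast
        then show ?thesis using z 3 by blast
      qed
    qed
    with w(2) show ?thesis by blast
  qed
  have "reach_in V s t" using t by (simp add: eqv_def)
  then have "eqv s t \<and> \<not> conn (D - {t p}) d (t q)"
    using s(1)
  proof (induction rule: reach_in_induct)
    case refl
    have "s q \<noteq> d" using s sp S_inj by metis
    then show ?case using eqv_refl[OF s(1)] conn_mem[of "D - {s p}" d "s q"] sp by auto
  next
    case (step t u)
    obtain r y where r: "r \<in> P" "hole t y" "adj (t r) y" "u = t(r := y)"
      using step by (auto simp: move_in_def)
    have etu: "eqv s u" using step eqv_trans by (auto simp: eqv_def intro: reach_in_move)
    have tD: "t p \<in> D" "t q \<in> D" "u p \<in> D" "u q \<in> D" using D step.IH etu by blast+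
    have pq: "t p \<noteq> t q" using s step.hyps S_inj by metis
    consider "r \<noteq> p" "r \<noteq> q" | "r = q" | "r = p" by blast
    then have "\<not> conn (D - {u p}) d (u q)"
    proof cases
      case 1
      then show ?thesis using r step.IH by simp
    next
      case 2
      have up: "u p = t p" "u q = y" using 2 r s by auto
      have yp: "y \<noteq> t p" using r s hole_neq by blast
      show ?thesis
      proof
        assume "conn (D - {u p}) d (u q)"
        then have "conn (D - {t p}) d (t q)"
          using up r 2 tD pq yp by (auto intro: conn_step adj_sym)
        then show False using step.IH by blast
      qed
    next
      case 3
      have up: "u p = y" "u q = t q" using 3 r s by auto
      show ?thesis
      proof
        assume "conn (D - {u p}) d (u q)"
        then have "conn (D - {t p}) d (t q)"
          using keep[of "t p" y "t q"] up r 3 tD pq by simp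
        then show False using step.IH by blast
      qed
    qed
    with etu show ?case ..
  qed
  then show ?thesis by auto
qed

lemma equal_ranges_exchangeable:
  assumes f: "f \<in> S" "p \<in> P" "q \<in> P"
    and R: "reachable_range P G p f = reachable_range P G q f"
    and nc: "\<not> is_cycle_graph G"
  shows "xch f p q"
proof (cases "p = q")
  case True
  then show ?thesis using f xch_refl by simp
next
  case pq: False
  define D where "D = reachable_range P G p f"
  have D: "D = {h p | h. eqv f h}" "D = {h q | h. eqv f h}"
    using R by (simp_all add: D_def reachable_range_eq)
  have Dp: "\<exists>t. eqv f t \<and> t p = x" if "x \<in> D" for x using that unfolding D(1) by blast
  have Dq: "\<exists>t. eqv f t \<and> t q = x" if "x \<in> D" for x using that unfolding D(2) by blast
  have inDp: "t p \<in> D" if "eqv f t" for t unfolding D(1) using that by blast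
  have inDq: "t q \<in> D" if "eqv f t" for t unfolding D(2) using that by blast
  note inD = inDp inDq
  show ?thesis
  proof (cases "\<exists>v\<in>D. \<exists>a\<in>D. \<exists>b\<in>D. a \<noteq> b \<and> adj v a \<and> adj v b \<and> 3 \<le> card (nbrs v)")
    case True
    then obtain v a b where v: "v \<in> D" "a \<in> D" "b \<in> D" "a \<noteq> b" "adj v a" "adj v b"
      "3 \<le> card (nbrs v)" by blast
    \<comment> \<open>If \<open>r\<close> were never passable on \<open>v\<close>,
      \<open>single_nbr_in_range\<close> would leave only one neighbour of \<open>v\<close> in
      \<open>D\<close>, but \<open>a\<close> and \<open>b\<close> are two.\<close>
    have free: "\<exists>s. eqv f s \<and> s r = v \<and> passable v s"
      if r: "r \<in> P" "\<And>x. x \<in> D \<Longrightarrow> \<exists>t. eqv f t \<and> t r = x" for r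
    proof (rule ccontr)
      assume none: "\<not> ?thesis"
      obtain s0 where s0: "eqv f s0" "s0 r = v" using r v by blast
      have "\<And>s. eqv s0 s \<Longrightarrow> s r = v \<Longrightarrow> \<not> passable v s"
        using none s0 eqv_trans by blast
      then obtain c where c: "\<And>s. eqv s0 s \<Longrightarrow> adj v (s r) \<Longrightarrow> s r = c"
        using single_nbr_in_range[OF eqvD(2)[OF s0(1)] r(1) s0(2)] by blast
      have "x = c" if x: "x \<in> D" "adj v x" for x
      proof -
        obtain t where t: "eqv f t" "t r = x" using r(2) x by blast
        then have "eqv s0 t" using s0 eqv_sym eqv_trans by blast
        then show ?thesis using c t x by blast
      qed
      then show False using v by metis
    qed
    obtain s0 s where s: "eqv f s0" "s0 p = v" "passable v s0" "eqv f s" "s q = v" "passable v s"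
      using free[OF f(2) Dp] free[OF f(3) Dq] by blast
    have "eqv s0 s" using s eqv_sym eqv_trans by blast
    then have "xch s0 p q"
      using passable_pebbles_exchangeable[OF v(7) f(2) s(2,3) _ f(3) s(5,6)] by blast
    then show ?thesis using s eqv_sym xch_eqv by blast
  next
    case False
    have branch: False if "x \<in> D" "a \<in> D" "b \<in> D" "adj x a" "adj x b" "adj x c"
      "a \<noteq> b" "a \<noteq> c" "b \<noteq> c" for x a b c
      using False that three_nbrs[of x a b c] by blast
    show ?thesis
    \<comment> \<open>An end of \<open>D\<close> is a vertex with at most one neighbour in
      \<open>D\<close>. With \<open>p\<close> placed on it, \<open>q\<close> can never get there,
      although \<open>D\<close> is also the range of \<open>q\<close>.\<close>
    proof (cases "\<exists>d\<in>D. \<forall>a\<in>D. \<forall>b\<in>D. adj d a \<longrightarrow> adj d b \<longrightarrow> a = b")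
      case True
      then obtain d where d: "d \<in> D" "\<And>a b. a \<in> D \<Longrightarrow> b \<in> D \<Longrightarrow> adj d a \<Longrightarrow> adj d b \<Longrightarrow> a = b"
        by blast
      obtain s t where st: "eqv f s" "s p = d" "eqv f t" "t q = d" using Dp Dq d by blast
      have "t q \<noteq> d"
      proof (rule separation_from_end[OF eqvD(2)[OF st(1)] f(2,3) pq])
        show "t' p \<in> D" "t' q \<in> D" if "eqv s t'" for t'
          using inD eqv_trans[OF st(1) that] by blast+
        show "eqv s t" using st eqv_sym eqv_trans by blast
      qed (fact branch d(2) st(2))+
      then show ?thesis using st by blast
    next
      case no_end: False
      have nbrs_D: "\<exists>a b. a \<noteq> b \<and> nbrs x = {a, b} \<and> a \<in> D \<and> b \<in> D" if x: "x \<in> D" for x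
      proof -
        obtain a b where ab: "a \<in> D" "b \<in> D" "adj x a" "adj x b" "a \<noteq> b" using no_end x by blast
        then have "nbrs x = {a, b}" using branch[OF x ab(1,2)] by blast
        then show ?thesis using ab by blast
      qed
      have "V \<subseteq> D"
      proof
        fix x assume "x \<in> V"
        then have "conn V (f p) x" using conn_V S_V f by blast
        then show "x \<in> D"
        proof (induction rule: conn_induct)
          case refl
          then show ?case using inD eqv_refl f by blast
        next
          case (step y z)
          then obtain a b where "nbrs y = {a, b}" "a \<in> D" "b \<in> D" using nbrs_D by blast
          moreover have "z \<in> nbrs y" using step by simp
          ultimately show ?case by auto
        qed
      qed
      then have "card (nbrs x) = 2" if "x \<in> V" for x
        using nbrs_D that by (metis card_2_iff subsetD)
      then show ?thesis using two_regular_is_cycle nc by blast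
    qed
  qed
qed

section \<open>Graphs other than cycles\<close>

text \<open>Each transposition puts one more pebble where \<open>g\<close> wants it:
  \<open>p\<close> is swapped with the pebble \<open>q\<close> that occupies \<open>g p\<close> in
  \<open>f\<close>.\<close>

lemma same_image_equal_ranges:
  assumes g: "g \<in> S" and nc: "\<not> is_cycle_graph G"
    and f: "f \<in> S" "f ` P = g ` P"
    and R: "\<And>p. p \<in> P \<Longrightarrow> reachable_range P G p f = reachable_range P G p g"
  shows "eqv f g"
  using f R
proof (induction "card {p \<in> P. f p \<noteq> g p}" arbitrary: f rule: less_induct)
  case less
  show ?case
  proof (cases "\<forall>p\<in>P. f p = g p")
    case True
    then have "f = g" using less.prems g S_eqI by blast
    then show ?thesis using g eqv_refl by simp
  next
    case False
    then obtain p where p: "p \<in> P" "f p \<noteq> g p" by blast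
    define \<pi> where "\<pi> = (\<lambda>x. if x \<in> P then inv_into P f (g x) else x)"
    have fpi: "f (\<pi> x) = g x" "\<pi> x \<in> P" if "x \<in> P" for x
      using that less.prems(2) by (auto simp: \<pi>_def f_inv_into_f inv_into_into)
    have "inj_on \<pi> P" using fpi(1) g by (metis S_iff inj_on_def)
    then have "bij_betw \<pi> P P"
      using fpi(2) finite_P by (simp add: bij_betw_def endo_inj_surj image_subset_iff)
    then have perm: "\<pi> permutes P" by (rule bij_imp_permutes) (simp add: \<pi>_def)
    have gpi: "f \<circ> \<pi> = g"
    proof (rule S_eqI[OF relabel_S[OF less.prems(1) perm] g])
    qed (simp add: fpi)
    define q where "q = \<pi> p"
    have q: "q \<in> P" "f q = g p" "q \<noteq> p"
      using fpi[OF p(1)] p(2) by (auto simp: q_def)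
    \<comment> \<open>Both inclusions come from \<open>g = f \<circ> \<pi>\<close> with
      \<open>\<pi> p = q\<close>: relabelling by \<open>\<pi>\<close>, or by its inverse, turns
      \<open>q\<close> started from \<open>f\<close> into \<open>p\<close> started from
      \<open>g\<close>. Together with the hypothesis on \<open>p\<close> this equates the ranges of
      \<open>p\<close> and \<open>q\<close> from \<open>f\<close>.\<close>
    have "reachable_range P G q f \<subseteq> reachable_range P G p g"
    proof
      fix x assume "x \<in> reachable_range P G q f"
      then obtain h where h: "eqv f h" "x = h q" by (auto simp: reachable_range_eq)
      then have "eqv g (h \<circ> \<pi>)" using eqv_relabel[OF h(1) perm] gpi by simp
      moreover have "(h \<circ> \<pi>) p = x" using h by (simp add: q_def)
      ultimately show "x \<in> reachable_range P G p g" unfolding reachable_range_eq by blast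
    qed
    moreover have "reachable_range P G p g \<subseteq> reachable_range P G q f"
    proof
      fix x assume "x \<in> reachable_range P G p g"
      then obtain h where h: "eqv g h" "x = h p" by (auto simp: reachable_range_eq)
      have "eqv (g \<circ> inv \<pi>) (h \<circ> inv \<pi>)" by (rule eqv_relabel[OF h(1) permutes_inv[OF perm]])
      moreover have "g \<circ> inv \<pi> = f"
        unfolding gpi[symmetric] comp_assoc by (simp add: permutes_inv_o[OF perm])
      moreover have "(h \<circ> inv \<pi>) q = x" using h by (simp add: q_def permutes_inverses[OF perm])
      ultimately have "eqv f (h \<circ> inv \<pi>)" "(h \<circ> inv \<pi>) q = x" by simp_all
      then show "x \<in> reachable_range P G q f" unfolding reachable_range_eq by blast
    qed
    ultimately have "reachable_range P G p f = reachable_range P G q f"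
      using less.prems(3) p by simp
    then have "xch f p q" using equal_ranges_exchangeable less.prems(1) p q nc by blast
    then have ef: "eqv f (f \<circ> transpose p q)" by (simp add: xch_def)
    define f' where "f' = f \<circ> transpose p q"
    have f': "f' \<in> S" using ef eqvD f'_def by blast
    have im: "f' ` P = g ` P"
      using less.prems(2) permutes_image[OF transpose_permutes[OF p(1) q(1)]]
      by (simp only: f'_def image_comp[symmetric])
    have "reachable_range P G r f' = reachable_range P G r f" for r
      unfolding reachable_range_eq f'_def using ef eqv_sym eqv_trans by blast
    then have R': "reachable_range P G r f' = reachable_range P G r g" if "r \<in> P" for r
      using less.prems(3) that by simp
    \<comment> \<open>\<open>q\<close> was misplaced as well, since \<open>f q = g p\<close>; hence
      the swap creates no new disagreement while it repairs \<open>p\<close>.\<close>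
    have "f q \<noteq> g q" using q p g S_inj by metis
    then have "{r \<in> P. f' r \<noteq> g r} \<subseteq> {r \<in> P. f r \<noteq> g r} - {p}"
      using q p by (auto simp: f'_def transpose_def)
    moreover have "p \<in> {r \<in> P. f r \<noteq> g r}" using p by simp
    ultimately have "card {r \<in> P. f' r \<noteq> g r} < card {r \<in> P. f r \<noteq> g r}"
      using finite_P by (intro psubset_card_mono) auto
    then have "eqv f' g" using less.hyps f' im R' by blast
    then show ?thesis using ef eqv_trans f'_def by blast
  qed
qed

text \<open>First the occupied sets are made equal inside the class of \<open>f\<close>, which
  changes no range; what remains is a permutation of the pebbles.\<close>

lemma equal_ranges_eqv:
  assumes f: "f \<in> S" "g \<in> S" and nc: "\<not> is_cycle_graph G"
    and R: "\<And>p. p \<in> P \<Longrightarrow> reachable_range P G p f = reachable_range P G p g"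
  shows "eqv f g"
proof -
  have card: "card (s ` P) = card P" if "s \<in> S" for s
    using that by (simp add: S_iff card_image)
  have sub: "s ` P \<subseteq> V" if "s \<in> S" for s using that S_V by blast
  have "\<exists>t. reach_in V f t \<and> t ` P \<inter> V = g ` P"
    using f card sub conn_V by (intro arrange_holes) (auto simp: Int_absorb2)
  then obtain t where t: "reach_in V f t" "t ` P \<inter> V = g ` P" by blast
  have e: "eqv f t" using t f eqv_reach by blast
  have tS: "t \<in> S" using e eqvD by blast
  have "t ` P = g ` P" using t(2) sub[OF tS] by blast
  moreover have "reachable_range P G p t = reachable_range P G p f" for p
    unfolding reachable_range_eq using e eqv_sym eqv_trans by blast
  ultimately have "eqv t g" using same_image_equal_ranges tS f nc R by simp
  then show ?thesis using e eqv_trans by blast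
qed

end

section \<open>Cycles\<close>

definition cyc :: "nat \<Rightarrow> nat \<Rightarrow> nat \<Rightarrow> bool" where
  "cyc i j k \<longleftrightarrow> i < j \<and> j < k \<or> j < k \<and> k < i \<or> k < i \<and> i < j"

lemma cyc_rotate: "cyc i j k \<longleftrightarrow> cyc j k i"
  by (auto simp: cyc_def)

text \<open>No index lies strictly between cyclically consecutive ones, so a step that lands on
  neither \<open>j\<close> nor \<open>k\<close> cannot jump over them, also at the wrap from
  \<open>n - 1\<close> to 0.\<close>

lemma cyc_shift:
  assumes "cyc i j k" "i < n" "i' < n" "j < n" "k < n" "i' = Suc i mod n \<or> i = Suc i' mod n"
    "i' \<noteq> j" "i' \<noteq> k"
  shows "cyc i' j k"
  using assms by (auto simp: cyc_def mod_Suc split: if_splits)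

lemma Suc_add_mod_neq:
  assumes "i < n" "Suc d < (n :: nat)"
  shows "(Suc i + d) mod n \<noteq> i"
proof (cases "Suc i + d < n")
  case False
  then have "(Suc i + d) mod n = Suc i + d - n"
    using assms by (simp add: le_mod_geq)
  then show ?thesis using assms False by simp
qed simp

locale cycle_puzzle = pebble_puzzle +
  fixes vs :: "'a list"
  assumes listing: "cyclic_listing G vs"
begin

abbreviation "n \<equiv> length vs"

definition pos :: "'a \<Rightarrow> nat" where
  "pos x = inv_into {..<n} ((!) vs) x"

section \<open>Positions along the listing\<close>

lemma n3: "3 \<le> n" and distinct_vs: "distinct vs" and set_vs: "set vs = V"
  and adj_nth: "i < n \<Longrightarrow> j < n \<Longrightarrow> adj (vs ! i) (vs ! j) \<longleftrightarrow> j = Suc i mod n \<or> i = Suc j mod n"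
  using listing unfolding cyclic_listing_def by auto

lemma nth_inj: "i < n \<Longrightarrow> j < n \<Longrightarrow> vs ! i = vs ! j \<longleftrightarrow> i = j"
  using distinct_vs by (simp add: nth_eq_iff_index_eq)

lemma pos_nth [simp]: "i < n \<Longrightarrow> pos (vs ! i) = i"
  unfolding pos_def by (rule inv_into_f_f) (auto simp: inj_on_def nth_inj)

lemma nth_pos:
  assumes "x \<in> V"
  shows "pos x < n \<and> vs ! pos x = x"
proof -
  have "x \<in> set vs" using assms by (simp only: set_vs)
  then obtain i where "i < n" "vs ! i = x" by (auto simp only: in_set_conv_nth)
  then show ?thesis using pos_nth[of i] by simp
qed

lemma nth_V: "i < n \<Longrightarrow> vs ! i \<in> V"
  using nth_mem[of i vs] by (simp only: set_vs)

lemma pos_eq: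
  assumes "x \<in> V" "y \<in> V"
  shows "pos x = pos y \<longleftrightarrow> x = y"
proof
  assume "pos x = pos y"
  then have "vs ! pos x = vs ! pos y" by simp
  then show "x = y" unfolding nth_pos[OF assms(1), THEN conjunct2] nth_pos[OF assms(2), THEN conjunct2] .
qed simp

lemma cyclic_order_iff:
  assumes "s \<in> S"
  shows "(p, q, r) \<in> pebble_cyclic_order P vs s \<longleftrightarrow>
    p \<in> P \<and> q \<in> P \<and> r \<in> P \<and> cyc (pos (s p)) (pos (s q)) (pos (s r))"
proof
  assume "(p, q, r) \<in> pebble_cyclic_order P vs s"
  then show "p \<in> P \<and> q \<in> P \<and> r \<in> P \<and> cyc (pos (s p)) (pos (s q)) (pos (s r))"
    unfolding pebble_cyclic_order_def cyc_def by auto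
next
  assume *: "p \<in> P \<and> q \<in> P \<and> r \<in> P \<and> cyc (pos (s p)) (pos (s q)) (pos (s r))"
  have "pos (s x) < n" "s x = vs ! pos (s x)" if "x \<in> P" for x
    using nth_pos[OF S_V[OF assms that]] by simp_all
  with * have "\<exists>i j k. i < n \<and> j < n \<and> k < n \<and> s p = vs ! i \<and> s q = vs ! j \<and> s r = vs ! k \<and>
      cyc i j k"
    by (intro exI[of _ "pos (s p)"] exI[of _ "pos (s q)"] exI[of _ "pos (s r)"]) simp
  with * show "(p, q, r) \<in> pebble_cyclic_order P vs s"
    by (simp add: pebble_cyclic_order_def cyc_def)
qed

text \<open>Rotating the triple puts the moving pebble first, where \<open>cyc_shift\<close>
  applies. One inclusion suffices, because moves are reversible.\<close>

lemma cyclic_order_move_subset: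
  assumes s: "s \<in> S" "move_in V s u"
  shows "pebble_cyclic_order P vs s \<subseteq> pebble_cyclic_order P vs u"
proof (intro subsetI, clarify)
  fix p q r assume "(p, q, r) \<in> pebble_cyclic_order P vs s"
  then have P: "p \<in> P" "q \<in> P" "r \<in> P" and c: "cyc (pos (s p)) (pos (s q)) (pos (s r))"
    using cyclic_order_iff[OF s(1)] by blast+
  obtain z y where z: "z \<in> P" "hole s y" "adj (s z) y" "u = s(z := y)"
    using s by (auto simp: move_in_def)
  have uS: "u \<in> S" using s move_in_S by blast
  have lt: "pos (s x) < n" if "x \<in> P" for x using nth_pos S_V s that by blast
  have yV: "y \<in> V" using z hole_V by blast
  have y: "pos y < n" "pos y = Suc (pos (s z)) mod n \<or> pos (s z) = Suc (pos y) mod n"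
  proof -
    have *: "pos (s z) < n" "vs ! pos (s z) = s z" "pos y < n" "vs ! pos y = y"
      using nth_pos[OF yV] nth_pos[OF S_V[OF s(1) z(1)]] by blast+
    then show "pos y < n" by blast
    show "pos y = Suc (pos (s z)) mod n \<or> pos (s z) = Suc (pos y) mod n"
      using adj_nth[OF *(1,3)] z(3) unfolding *(2,4) by blast
  qed
  have ne: "pos y \<noteq> pos (s x)" if "x \<in> P" for x
    using pos_eq[OF yV S_V[OF s(1) that]] hole_neq[OF z(2) that] by auto
  have pqr: "p \<noteq> q" "q \<noteq> r" "p \<noteq> r" using c by (auto simp: cyc_def)
  have shift: "cyc (pos y) j k" if "cyc (pos (s z)) j k" "j < n" "k < n" "pos y \<noteq> j" "pos y \<noteq> k" for j k
    using cyc_shift[OF that(1) lt[OF z(1)] y(1) that(2,3) y(2) that(4,5)] .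
  consider "z = p" | "z = q" | "z = r" | "z \<notin> {p, q, r}" by blast
  then have "cyc (pos (u p)) (pos (u q)) (pos (u r))"
  proof cases
    case 1
    then show ?thesis using shift[of "pos (s q)" "pos (s r)"] c lt ne P z pqr by simp
  next
    case 2
    then have "cyc (pos y) (pos (s r)) (pos (s p))"
      using shift[of "pos (s r)" "pos (s p)"] c[unfolded cyc_rotate[of "pos (s p)"]] lt ne P by simp
    then have "cyc (pos (s p)) (pos y) (pos (s r))" using cyc_rotate by blast
    then show ?thesis using 2 z(4) pqr by simp
  next
    case 3
    then have "cyc (pos y) (pos (s p)) (pos (s q))"
      using shift[of "pos (s p)" "pos (s q)"] c[folded cyc_rotate[of "pos (s r)"]] lt ne P by simp
    then have "cyc (pos (s p)) (pos (s q)) (pos y)" using cyc_rotate by blast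
    then show ?thesis using 3 z(4) pqr by simp
  next
    case 4
    then show ?thesis using c z by auto
  qed
  then show "(p, q, r) \<in> pebble_cyclic_order P vs u" using cyclic_order_iff[OF uS] P by blast
qed

lemma cyclic_order_eqv:
  assumes "eqv s t"
  shows "pebble_cyclic_order P vs s = pebble_cyclic_order P vs t"
proof -
  have "reach_in V s t" "s \<in> S" using assms by (auto simp: eqv_def)
  then show ?thesis
  proof (induction rule: reach_in_induct)
    case (step t u)
    then show ?case using cyclic_order_move_subset move_in_sym by blast
  qed simp
qed

lemma conn_avoiding:
  assumes i: "i < n" and x: "x \<in> V - {vs ! i}" "y \<in> V - {vs ! i}"
  shows "conn (V - {vs ! i}) x y"
proof -
  \<comment> \<open>Walks the path that remains of the cycle, starting just after position
    \<open>i\<close>; the values \<open>d < n - 1\<close> cover every vertex except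
    \<open>vs ! i\<close>.\<close>
  let ?c = "\<lambda>d. vs ! ((Suc i + d) mod n)"
  have n0: "n > 0" using n3 by linarith
  have inX: "?c d \<in> V - {vs ! i}" if "Suc d < n" for d
    using Suc_add_mod_neq[OF i that] nth_V[of "(Suc i + d) mod n"]
      nth_inj[of "(Suc i + d) mod n" i] i n0 by auto
  have from0: "conn (V - {vs ! i}) (?c 0) (?c d)" if "Suc d < n" for d
    using that
  proof (induction d)
    case (Suc d)
    have "adj (?c d) (?c (Suc d))"
      using n0 by (subst adj_nth) (auto simp: mod_Suc_eq)
    then show ?case using Suc inX[of d] inX[of "Suc d"] conn_step by simp
  qed simp
  have reach: "conn (V - {vs ! i}) (?c 0) z" if z: "z \<in> V - {vs ! i}" for z
  proof -
    have l: "pos z < n" "vs ! pos z = z" using nth_pos z by auto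
    then have "pos z \<noteq> i" using z by auto
    then have "\<exists>d. Suc d < n \<and> (Suc i + d) mod n = pos z"
    proof (cases "i < pos z")
      case True
      then show ?thesis using l by (intro exI[of _ "pos z - Suc i"]) auto
    next
      case False
      have "Suc i + (pos z + n - Suc i) = pos z + n" using i by linarith
      then have "(Suc i + (pos z + n - Suc i)) mod n = pos z"
        using l(1) by (simp only: mod_add_self2 mod_less)
      moreover have "Suc (pos z + n - Suc i) < n" using False i \<open>pos z \<noteq> i\<close> by linarith
      ultimately show ?thesis by blast
    qed
    then show ?thesis using from0 l by metis
  qed
  show ?thesis using reach x conn_sym conn_trans by blast
qed

section \<open>Normal forms on a cycle\<close>

lemma rotate_to_start:
  assumes "s \<in> S" "p \<in> P"
  obtains t where "eqv s t" "t p = vs ! 0"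
proof -
  have "\<exists>t. eqv s t \<and> t p = vs ! 0"
    using assms(1)
  proof (induction "pos (s p)" arbitrary: s)
    case 0
    then have "s p = vs ! 0" using nth_pos[OF S_V[OF 0(2) assms(2)]] by simp
    then show ?case using 0 eqv_refl by blast
  next
    case (Suc i)
    have i: "Suc i < n" "s p = vs ! Suc i"
      using nth_pos[OF S_V[OF Suc.prems assms(2)]] Suc.hyps(2) by simp_all
    obtain w where w: "hole s w" "w \<noteq> s p" by (rule other_hole[OF Suc.prems])
    have wX: "w \<in> V - {vs ! Suc i}" using w i hole_V by auto
    have iX: "vs ! i \<in> V - {vs ! Suc i}" using i nth_V nth_inj[of i "Suc i"] by auto
    obtain t where t: "reach_in (V - {vs ! Suc i}) s t" "hole t (vs ! i)"
      \<comment> \<open>The cycle without the place of \<open>p\<close> is still connected, so a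
        hole can be brought just before \<open>p\<close> while \<open>p\<close> stays; then
        \<open>p\<close> steps back by one position.\<close>
      by (rule shift_hole[OF Suc.prems w(1) wX conn_avoiding[OF i(1) wX iX]])
    have tp: "t p = vs ! Suc i" using reach_in_outside[OF Suc.prems t(1) assms(2)] i by simp
    have tS: "t \<in> S" using t Suc.prems reach_in_S by blast
    have "adj (t p) (vs ! i)" unfolding tp using i by (subst adj_nth) auto
    then have e: "eqv t (t(p := vs ! i))" by (rule eqv_upd[OF tS assms(2) t(2)])
    have "i = pos ((t(p := vs ! i)) p)" using i by simp
    then obtain u where "eqv (t(p := vs ! i)) u" "u p = vs ! 0"
      using Suc.hyps(1) eqvD(2)[OF e] by blast
    then show ?case using e eqv_reach[OF Suc.prems t(1)] eqv_trans by blast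
  qed
  with that show thesis by blast
qed

text \<open>With \<open>p\<close> held at position 0, the rest of the cycle is a connected set in
  which \<open>arrange_holes\<close> packs the other \<open>card P - 1\<close> pebbles onto
  positions 1 to \<open>card P - 1\<close>.\<close>

lemma normal_form:
  assumes "s \<in> S" "p \<in> P"
  obtains t where "eqv s t" "t p = vs ! 0" "t ` (P - {p}) = (!) vs ` {1..<card P}"
proof -
  obtain t where t: "eqv s t" "t p = vs ! 0" by (rule rotate_to_start[OF assms])
  note tS = eqvD(2)[OF t(1)]
  let ?X = "V - {vs ! 0}"
  let ?J = "(!) vs ` {1..<card P}"
  have n0: "0 < n" using n3 by linarith
  have "card V = n" using distinct_card[OF distinct_vs] set_vs by simp
  then have mn: "card P < n" using two_holes by simp
  have rest: "u ` P \<inter> ?X = u ` (P - {p})" if "u \<in> S" "u p = vs ! 0" for u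
    using that assms S_V S_inj by (auto simp: image_iff) metis
  have "card ?J = card P - 1"
    by (subst card_image) (use mn in \<open>auto simp: inj_on_def nth_inj\<close>)
  moreover have "card (t ` (P - {p})) = card P - 1"
    using tS assms finite_P by (subst card_image) (auto simp: S_iff inj_on_def)
  ultimately have "card ?J = card (t ` P \<inter> ?X)" using rest tS t by simp
  moreover have "?J \<subseteq> ?X" using mn nth_V nth_inj[of _ 0] n0 by auto
  ultimately obtain u where u: "reach_in ?X t u" "u ` P \<inter> ?X = ?J"
    using arrange_holes[OF tS, of ?X ?J] conn_avoiding[OF n0] by blast
  have "u p = vs ! 0" using reach_in_outside[OF tS u(1) assms(2)] t by simp
  moreover have "eqv t u" using eqv_reach[OF tS u(1)] .
  ultimately show thesis
    using that[of u] eqv_trans[OF t(1)] rest[of u] u(2) eqvD(2) by simp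
qed

text \<open>As the pebbles other than \<open>p\<close> fill the positions from 1 on without gaps,
  the position of \<open>q\<close> is one more than the number of pebbles met between
  \<open>p\<close> and \<open>q\<close>, and the cyclic order determines that number.\<close>

lemma normal_form_unique:
  assumes u: "u \<in> S" "p \<in> P" "u p = vs ! 0" "u ` (P - {p}) = (!) vs ` {1..<card P}"
    and t: "t \<in> S" "t p = vs ! 0" "t ` (P - {p}) = (!) vs ` {1..<card P}"
    and eq: "pebble_cyclic_order P vs u = pebble_cyclic_order P vs t"
  shows "u = t"
proof -
  have "card V = n" using distinct_card[OF distinct_vs] set_vs by simp
  then have mn: "card P < n" using two_holes by simp
  have n0: "0 < n" using n3 by linarith
  have rank: "pos (s q) = Suc (card {r \<in> P - {p}. (p, r, q) \<in> pebble_cyclic_order P vs s})"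
    if s: "s \<in> S" "s p = vs ! 0" "s ` (P - {p}) = (!) vs ` {1..<card P}" and q: "q \<in> P - {p}" for s q
  proof -
    have im: "(\<lambda>r. pos (s r)) ` (P - {p}) = {1..<card P}"
    proof -
      have "(\<lambda>r. pos (s r)) ` (P - {p}) = pos ` (!) vs ` {1..<card P}"
        unfolding s(3)[symmetric] by (simp add: image_image)
      also have "\<dots> = (\<lambda>i. i) ` {1..<card P}"
        unfolding image_image by (rule image_cong) (use mn in auto)
      finally show ?thesis by simp
    qed
    have inj: "inj_on (\<lambda>r. pos (s r)) (P - {p})"
      using s(1) S_V pos_eq S_inj by (auto simp: inj_on_def)
    have pq: "1 \<le> pos (s r)" "pos (s r) < card P" if "r \<in> P - {p}" for r
    proof -
      have "pos (s r) \<in> {1..<card P}" unfolding im[symmetric] using that by (rule imageI)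
      then show "1 \<le> pos (s r)" "pos (s r) < card P" by simp_all
    qed
    have sp: "pos (s p) = 0" using n0 by (simp only: s(2) pos_nth)
    have "(p, r, q) \<in> pebble_cyclic_order P vs s \<longleftrightarrow> pos (s r) < pos (s q)" if "r \<in> P - {p}" for r
      unfolding cyclic_order_iff[OF s(1)] cyc_def sp using u(2) q that pq[OF that] pq[OF q] by auto
    then have eq: "{r \<in> P - {p}. (p, r, q) \<in> pebble_cyclic_order P vs s} =
        {r \<in> P - {p}. pos (s r) < pos (s q)}" by blast
    have "(\<lambda>r. pos (s r)) ` {r \<in> P - {p}. pos (s r) < pos (s q)} =
        (\<lambda>r. pos (s r)) ` (P - {p}) \<inter> {..<pos (s q)}" by blast
    also have "\<dots> = {1..<pos (s q)}" unfolding im using pq[OF q] by auto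
    finally have "card {1..<pos (s q)} = card {r \<in> P - {p}. pos (s r) < pos (s q)}"
      using card_image[OF inj_on_subset[OF inj], of "{r \<in> P - {p}. pos (s r) < pos (s q)}"] by auto
    then show ?thesis unfolding eq using pq[OF q] by simp
  qed
  show ?thesis
  proof (rule S_eqI[OF u(1) t(1)])
    fix q assume q: "q \<in> P"
    show "u q = t q"
    proof (cases "q = p")
      case False
      then have "pos (u q) = pos (t q)" using rank[OF u(1,3,4)] rank[OF t] q eq by simp
      then show ?thesis using pos_eq S_V u t q by blast
    qed (use u t in simp)
  qed
qed

lemma same_order_eqv:
  assumes f: "f \<in> S" "g \<in> S" and eq: "pebble_cyclic_order P vs f = pebble_cyclic_order P vs g"
  shows "eqv f g"
proof (cases "P = {}")
  case True
  then have "f = g" using f S_eqI by blast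
  then show ?thesis using f eqv_refl by simp
next
  case False
  then obtain p where p: "p \<in> P" by blast
  obtain u where u: "eqv f u" "u p = vs ! 0" "u ` (P - {p}) = (!) vs ` {1..<card P}"
    by (rule normal_form[OF f(1) p])
  obtain t where t: "eqv g t" "t p = vs ! 0" "t ` (P - {p}) = (!) vs ` {1..<card P}"
    by (rule normal_form[OF f(2) p])
  have "pebble_cyclic_order P vs u = pebble_cyclic_order P vs t"
    using eq cyclic_order_eqv[OF u(1)] cyclic_order_eqv[OF t(1)] by simp
  then have ut: "u = t"
    by (rule normal_form_unique[OF eqvD(2)[OF u(1)] p u(2,3) eqvD(2)[OF t(1)] t(2,3)])
  show ?thesis by (rule eqv_trans[OF u(1)[unfolded ut] eqv_sym[OF t(1)]])
qed

end

theorem theorem7: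
  fixes G :: "'v pair_pre_digraph" and P :: "'p set"
    and f g :: "'p \<Rightarrow> 'v" and n m k :: nat
  assumes "pair_graph G" and "connected (with_proj G)" and "card (pverts G) = n"
    and "finite P" and "card P = m"
    and "m \<le> n" and "k = n - m" and "k \<ge> 2"
    and "f \<in> configurations P G" and "g \<in> configurations P G"
  shows "pebble_equiv P G f g \<longleftrightarrow>
    (\<forall>p\<in>P. reachable_range P G p f = reachable_range P G p g) \<and>
    (is_cycle_graph G \<longrightarrow> same_cyclic_order P G f g)"
proof -
  interpret pair_graph G by fact
  interpret pebble_puzzle G P
    using assms by unfold_locales auto
  have cycle: "cycle_puzzle G P vs" if "cyclic_listing G vs" for vs
    using that by unfold_locales
  show ?thesis
  proof
    assume "pebble_equiv P G f g"
    then have e: "eqv f g" by (simp add: pebble_equiv_eq)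
    have "reachable_range P G p f = reachable_range P G p g" for p
      unfolding reachable_range_eq using e eqv_sym eqv_trans by blast
    moreover have "same_cyclic_order P G f g"
      unfolding same_cyclic_order_def using cycle cycle_puzzle.cyclic_order_eqv e by blast
    ultimately show "(\<forall>p\<in>P. reachable_range P G p f = reachable_range P G p g) \<and>
        (is_cycle_graph G \<longrightarrow> same_cyclic_order P G f g)" by blast
  next
    assume *: "(\<forall>p\<in>P. reachable_range P G p f = reachable_range P G p g) \<and>
        (is_cycle_graph G \<longrightarrow> same_cyclic_order P G f g)"
    have "eqv f g"
    proof (cases "is_cycle_graph G")
      case True
      then obtain vs where vs: "cyclic_listing G vs" by (auto simp: is_cycle_graph_def)
      then show ?thesis
        using * True assms(9,10) cycle_puzzle.same_order_eqv[OF cycle[OF vs]]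
        by (simp add: same_cyclic_order_def)
    next
      case False
      then show ?thesis using equal_ranges_eqv assms(9,10) * by blast
    qed
    then show "pebble_equiv P G f g" by (simp add: pebble_equiv_eq)
  qed
qed

end
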